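(* There is a universal constant $A\in(1,\infty)$ such that the following holds. Let $\mu$ be a nontrivial probability measure on $\partial\mathbb{D}$ with orthonormal polynomials $\varphi_n$, second-kind polynomials $\psi_n$, and Carathéodory function $F$. For $z\in\partial\mathbb{D}$ and $r\in[0,1)$, define $x(r)\in[0,\infty)$ to be the unique solution of $$(1-r)\,\|\varphi_{\boldsymbol{\cdot}}(z)\|_{x(r)}\,\|\psi_{\boldsymbol{\cdot}}(z)\|_{x(r)}=\sqrt2 .$$ Then $$A^{-1}\left[\frac{\|\psi_{\boldsymbol{\cdot}}(z)\|_{x(r)}}{\|\varphi_{\boldsymbol{\cdot}}(z)\|_{x(r)}}\right]\le|F(rz)|\le A\left[\frac{\|\psi_{\boldsymbol{\cdot}}(z)\|_{x(r)}}{\|\varphi_{\boldsymbol{\cdot}}(z)\|_{x(r)}}\right].$$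
   Context: $\mathbb{D}=\{|z|<1\}$. A probability measure on $\partial\mathbb{D}$ is nontrivial if it is not a finite combination of delta functions. $\Phi_n$ is the monic orthogonal polynomial of degree $n$ in $L^2(\partial\mathbb{D},d\mu)$, $\varphi_n=\Phi_n/\|\Phi_n\|_{L^2}$, and the Verblunsky coefficients are $\alpha_n=-\overline{\Phi_{n+1}(0)}\in\mathbb{D}$, $n\ge0$; they determine the measure and every sequence in $\mathbb{D}$ occurs. $\psi_n$ are the orthonormal polynomials of the measure with Verblunsky coefficients $\{-\alpha_n\}_{n=0}^\infty$. The Carathéodory function is $F(z)=\int\frac{e^{i\theta}+z}{e^{i\theta}-z}\,d\mu(\theta)$, $z\in\mathbb{D}$. For $x\in[0,\infty)$, $[x]$ denotes the integral part of $x$, and for a sequence $a=\{a_j\}_{j=0}^\infty$, $$\|a\|_x^2=\sum_{j=0}^{[x]}|a_j|^2+(x-[x])\,|a_{[x]+1}|^2 .$$ $\varphi_{\boldsymbol{\cdot}}(z)$ denotes the sequence $\{\varphi_n(z)\}_{n=0}^\infty$, and similarly for $\psi_{\boldsymbol{\cdot}}(z)$. *)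

theory Defs
  imports "HOL-Probability.Probability" "HOL-Computational_Algebra.Polynomial"
begin

definition circle_prob_measure :: "complex measure \<Rightarrow> bool" where
  "circle_prob_measure \<mu> \<longleftrightarrow>
     prob_space \<mu> \<and> sets \<mu> = sets (restrict_space borel (sphere (0::complex) 1))"

text \<open>The library's unit point mass at \<open>w\<close>, on the sigma-algebra of \<open>\<mu>\<close>, is \<open>return \<mu> w\<close>.\<close>

definition nontrivial_circle_measure :: "complex measure \<Rightarrow> bool" where
  "nontrivial_circle_measure \<mu> \<longleftrightarrow>
     circle_prob_measure \<mu> \<and>
     \<not> (\<exists>(S :: complex set) (c :: complex \<Rightarrow> real).
          finite S \<and> S \<subseteq> sphere 0 1 \<and>
          (\<forall>E\<in>sets \<mu>. measure \<mu> E = (\<Sum>w\<in>S. c w * measure (return \<mu> w) E)))"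

text \<open>For nontrivial \<open>\<mu>\<close> exactly one polynomial satisfies the description, for every \<open>n\<close>.\<close>

definition monic_op :: "complex measure \<Rightarrow> nat \<Rightarrow> complex poly" where
  "monic_op \<mu> n =
     (THE p. degree p = n \<and> lead_coeff p = 1 \<and>
        (\<forall>q. degree q < n \<longrightarrow> (LINT w|\<mu>. cnj (poly q w) * poly p w) = 0))"

definition orthonormal_op :: "complex measure \<Rightarrow> nat \<Rightarrow> complex poly" where
  "orthonormal_op \<mu> n =
     smult (complex_of_real (1 / sqrt (LINT w|\<mu>. (cmod (poly (monic_op \<mu> n) w))\<^sup>2)))
           (monic_op \<mu> n)"

definition verblunsky :: "complex measure \<Rightarrow> nat \<Rightarrow> complex" where
  "verblunsky \<mu> n = - cnj (poly (monic_op \<mu> (Suc n)) 0)"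

text \<open>By Verblunsky's theorem, for nontrivial \<open>\<mu>\<close> there is exactly one such measure \<open>\<nu>\<close>, so
  the choice operator picks the measure with Verblunsky coefficients \<open>-\<alpha>\<^sub>n\<close>.\<close>

definition second_kind_measure :: "complex measure \<Rightarrow> complex measure" where
  "second_kind_measure \<mu> =
     (SOME \<nu>. nontrivial_circle_measure \<nu> \<and> (\<forall>n. verblunsky \<nu> n = - verblunsky \<mu> n))"

definition second_kind_op :: "complex measure \<Rightarrow> nat \<Rightarrow> complex poly" where
  "second_kind_op \<mu> n = orthonormal_op (second_kind_measure \<mu>) n"

definition caratheodory_fun :: "complex measure \<Rightarrow> complex \<Rightarrow> complex" where
  "caratheodory_fun \<mu> z = (LINT w|\<mu>. (w + z) / (w - z))"

text \<open>The truncated \<open>\<ell>\<^sup>2\<close> norm of \<open>a\<close> at a real length \<open>x \<ge> 0\<close>, the squared norm being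
  interpolated linearly between integers; \<open>frac x\<close> is \<open>x - \<lfloor>x\<rfloor>\<close>. Meaningless for \<open>x < 0\<close>.\<close>

definition trunc_norm :: "(nat \<Rightarrow> complex) \<Rightarrow> real \<Rightarrow> real" where
  "trunc_norm a x =
     sqrt ((\<Sum>j=0..nat \<lfloor>x\<rfloor>. (cmod (a j))\<^sup>2) + frac x * (cmod (a (nat \<lfloor>x\<rfloor> + 1)))\<^sup>2)"

end

theory Submission
  imports Defs "HOL-Complex_Analysis.Complex_Analysis"
begin

text \<open>
  Fix \<open>z\<close> on the circle and put \<open>\<zeta> = r z\<close>. The sequence
  \<open>u\<^sub>n = \<psi>\<^sub>n(\<zeta>) + F(\<zeta>) \<phi>\<^sub>n(\<zeta>)\<close> equals
  \<open>\<integral> 2w/(w - \<zeta>) \<phi>\<^sub>n(w) d\<mu>(w)\<close>, so Bessel's inequality gives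
  \<open>(1 - r\<^sup>2) \<Sum> |u\<^sub>n|\<^sup>2 \<le> 4 Re F(\<zeta>)\<close>. Since the transfer matrices at \<open>\<zeta>\<close> and
  \<open>z\<close> differ by the factor \<open>diag(r, 1)\<close>, variation of parameters expresses
  \<open>F(\<zeta>) \<phi>\<^sub>n(z) + \<psi>\<^sub>n(z)\<close> as \<open>u\<^sub>n\<close> plus a perturbation of relative size
  \<open>(1 - r) \<parallel>\<phi>\<parallel>\<^sub>x \<parallel>\<psi>\<parallel>\<^sub>x = \<surd>2\<close>. Hence \<open>X = |F| \<parallel>\<phi>\<parallel>\<^sub>x\<close> and \<open>Y = \<parallel>\<psi>\<parallel>\<^sub>x\<close> satisfy
  \<open>(X - Y)\<^sup>2 \<le> 18 X Y\<close>, which bounds \<open>X/Y\<close> from both sides. The measure with coefficients \<open>-\<alpha>\<^sub>n\<close>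
  is obtained as a weak limit of Bernstein-Szego measures.
\<close>

section \<open>Szego recursion and orthogonality on the circle\<close>

text \<open>The second component is the reversed polynomial \<open>\<Phi>\<^sub>n\<^sup>*(z) = z\<^sup>n cnj (\<Phi>\<^sub>n(1 / cnj z))\<close>,
  so no reversal operation on polynomials is needed.\<close>

fun szego szego_dual :: "(nat \<Rightarrow> complex) \<Rightarrow> nat \<Rightarrow> complex poly" where
  "szego a 0 = 1"
| "szego a (Suc n) = pCons 0 (szego a n) - smult (cnj (a n)) (szego_dual a n)"
| "szego_dual a 0 = 1"
| "szego_dual a (Suc n) = szego_dual a n - smult (a n) (pCons 0 (szego a n))"

lemma degree_szego_szego_dual:
  "degree (szego a n) = n \<and> lead_coeff (szego a n) = 1 \<and> degree (szego_dual a n) \<le> n"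
proof (induction n)
  case (Suc n)
  let ?p = "pCons 0 (szego a n)" and ?q = "szego_dual a n"
  have dp: "degree ?p = Suc n" using Suc by (subst degree_pCons_eq) auto
  have dq: "degree (smult c ?q) < Suc n" for c
    using Suc degree_smult_le[of c ?q] by linarith
  have 1: "degree (szego a (Suc n)) = Suc n"
    using degree_add_eq_left[of "- smult (cnj (a n)) ?q" ?p] dp dq[of "cnj (a n)"] by simp
  have "coeff (szego_dual a n) (Suc n) = 0" using Suc by (intro coeff_eq_0) auto
  moreover have "coeff (szego a n) n = 1" using Suc by metis
  ultimately have "coeff (szego a (Suc n)) (Suc n) = 1" by simp
  moreover have "degree (szego_dual a (Suc n)) \<le> Suc n"
    using Suc dp degree_smult_le[of "a n" ?p] by (auto intro!: degree_diff_le)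
  ultimately show ?case using 1 by simp
qed auto

lemma degree_szego [simp]: "degree (szego a n) = n"
  and lead_coeff_szego [simp]: "coeff (szego a n) n = 1"
  and degree_szego_dual: "degree (szego_dual a n) \<le> n"
  using degree_szego_szego_dual[of a n] by auto

lemma szego_nonzero [simp]: "szego a n \<noteq> 0"
  using lead_coeff_szego[of a n] by (metis coeff_0 zero_neq_one)

lemma poly_szego_dual_0 [simp]: "poly (szego_dual a n) 0 = 1"
  by (induction n) auto

lemma cnj_mult_cmod_1: "cmod w = 1 \<Longrightarrow> w * cnj w = 1" "cmod w = 1 \<Longrightarrow> cnj w * w = 1"
  by (simp_all add: complex_norm_square[symmetric] mult.commute)

lemma szego_dual_circle:
  assumes "cmod w = 1"
  shows "poly (szego_dual a n) w = w ^ n * cnj (poly (szego a n) w)"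
proof (induction n)
  case (Suc n)
  have w: "w * cnj w = 1" using cnj_mult_cmod_1 assms by blast
  have "w ^ n * cnj (w ^ n) = 1"
    using w by (metis complex_cnj_power power_mult_distrib power_one)
  hence p: "poly (szego a n) w = w ^ n * cnj (poly (szego_dual a n) w)"
    using Suc by (simp add: mult.assoc[symmetric])
  have "w ^ Suc n * cnj (poly (szego a (Suc n)) w) =
      (w * cnj w) * (w ^ n * cnj (poly (szego a n) w)) - a n * (w * (w ^ n * cnj (poly (szego_dual a n) w)))"
    by (simp add: algebra_simps)
  also have "\<dots> = poly (szego_dual a (Suc n)) w"
    using Suc p w by simp
  finally show ?case by simp
qed auto

text \<open>The induction also carries
  \<open>|\<Phi>\<^sub>n| \<le> |\<Phi>\<^sub>n\<^sup>*|\<close> on the closed disk; with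
  \<open>|a\<^sub>n| < 1\<close> this keeps the next reversed polynomial away from zero. It is what
  allows division by \<open>\<Phi>\<^sub>N\<^sup>*\<close> in the Bernstein-Szego
  construction.\<close>

lemma szego_dual_nonzero:
  assumes "\<And>n. cmod (a n) < 1" "cmod w \<le> 1"
  shows "poly (szego_dual a n) w \<noteq> 0"
proof -
  have "poly (szego_dual a n) w \<noteq> 0 \<and> cmod (poly (szego a n) w) \<le> cmod (poly (szego_dual a n) w)"
  proof (induction n)
    case (Suc n)
    define p where "p = w * poly (szego a n) w"
    define q where "q = poly (szego_dual a n) w"
    have pq: "cmod p \<le> cmod q"
      unfolding p_def q_def norm_mult
      using Suc assms(2) by (meson mult_left_le_one_le norm_ge_zero order_trans)
    have q: "q \<noteq> 0" using Suc by (simp add: q_def)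
    have ap: "cmod (a n * p) < cmod q"
    proof -
      have "cmod (a n * p) \<le> cmod (a n) * cmod q" using pq by (simp add: norm_mult mult_left_mono)
      also have "\<dots> < cmod q" using assms(1)[of n] q by simp
      finally show ?thesis .
    qed
    have "q - a n * p \<noteq> 0" using ap by auto
    moreover have "(cmod (p - cnj (a n) * q))\<^sup>2 \<le> (cmod (q - a n * p))\<^sup>2"
    proof -
      \<comment> \<open>One step of the recursion multiplies the indefinite form
        \<open>|q|\<^sup>2 - |p|\<^sup>2\<close> by \<open>1 - |a\<^sub>n|\<^sup>2\<close>, so its
        sign is preserved.\<close>
      have "(cmod (q - a n * p))\<^sup>2 - (cmod (p - cnj (a n) * q))\<^sup>2
          = (1 - (cmod (a n))\<^sup>2) * ((cmod q)\<^sup>2 - (cmod p)\<^sup>2)"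
        unfolding cmod_power2 by (simp add: algebra_simps power2_eq_square)
      moreover have "\<dots> \<ge> 0"
        using assms(1)[of n] pq by (intro mult_nonneg_nonneg) (auto simp: abs_square_le_1 power_mono)
      ultimately show ?thesis by linarith
    qed
    hence "cmod (p - cnj (a n) * q) \<le> cmod (q - a n * p)" by simp
    ultimately show ?case by (simp add: p_def q_def mult.left_commute)
  qed auto
  thus ?thesis by blast
qed

section \<open>Integration on the circle and orthogonality of the recursion polynomials\<close>

lemma circle_prob_measureD:
  assumes "circle_prob_measure \<mu>"
  shows "prob_space \<mu>" "space \<mu> = sphere 0 1" "sets \<mu> = sets (restrict_space borel (sphere (0::complex) 1))"
  using assms sets_eq_imp_space_eq[of \<mu> "restrict_space borel (sphere (0::complex) 1)"]
  by (auto simp: circle_prob_measure_def space_restrict_space)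

lemma circle_prob_measure_borel_measurable:
  assumes "circle_prob_measure \<mu>" "continuous_on (sphere 0 1) f"
  shows "f \<in> borel_measurable \<mu>"
  using borel_measurable_continuous_on_restrict[OF assms(2)] circle_prob_measureD(3)[OF assms(1)]
  by (simp cong: measurable_cong_sets)

lemma circle_prob_measure_integrable:
  fixes f :: "complex \<Rightarrow> 'a :: {banach, second_countable_topology}"
  assumes "circle_prob_measure \<mu>" "continuous_on (sphere 0 1) f"
  shows "integrable \<mu> f"
proof -
  interpret prob_space \<mu> using circle_prob_measureD assms by blast
  have "bounded (f ` sphere 0 1)"
    using assms(2) by (intro compact_imp_bounded compact_continuous_image) auto
  then obtain B where "\<forall>x\<in>sphere 0 1. norm (f x) \<le> B" by (auto simp: bounded_iff)
  thus ?thesis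
    using circle_prob_measure_borel_measurable[OF assms] circle_prob_measureD(2)[OF assms(1)]
    by (intro integrable_const_bound[where B=B]) (auto intro!: AE_I2)
qed

text \<open>The sequence \<open>a\<close> is not tied to \<mu> here. The same predicate thus serves
  both for the coefficients of a given measure and for constructing a measure with prescribed
  coefficients.\<close>

definition szego_orth :: "complex measure \<Rightarrow> (nat \<Rightarrow> complex) \<Rightarrow> nat \<Rightarrow> bool" where
  "szego_orth \<mu> a n \<longleftrightarrow> (\<forall>k<n. (LINT w|\<mu>. cnj (w ^ k) * poly (szego a n) w) = 0)"

lemma circle_integral_cong:
  assumes "circle_prob_measure \<mu>" "\<And>w. cmod w = 1 \<Longrightarrow> f w = g w"
  shows "integral\<^sup>L \<mu> f = integral\<^sup>L \<mu> g"
  using assms circle_prob_measureD(2)[OF assms(1)] by (intro Bochner_Integration.integral_cong) auto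

lemma cnj_power_mult_power:
  assumes "cmod w = 1" "k \<le> n"
  shows "cnj (w ^ k) * w ^ n = w ^ (n - k)"
proof -
  have "cnj (w ^ k) * w ^ n = (cnj w * w) ^ k * w ^ (n - k)"
    using assms(2) by (simp add: power_mult_distrib mult.assoc power_add[symmetric])
  thus ?thesis using cnj_mult_cmod_1(2)[OF assms(1)] by simp
qed

text \<open>On the circle the integrand is the conjugate of
  \<open>cnj (w^(n-k)) * \<Phi>\<^sub>n(w)\<close>, and \<open>k \<ge> 1\<close> makes the exponent
  smaller than \<open>n\<close>.\<close>

lemma circle_integral_szego_dual:
  assumes "circle_prob_measure \<mu>" "szego_orth \<mu> a n" "1 \<le> k" "k \<le> n"
  shows "(LINT w|\<mu>. cnj (w ^ k) * poly (szego_dual a n) w) = 0"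
proof -
  have "(LINT w|\<mu>. cnj (w ^ k) * poly (szego_dual a n) w)
      = (LINT w|\<mu>. cnj (cnj (w ^ (n - k)) * poly (szego a n) w))"
    using assms by (intro circle_integral_cong)
      (auto simp: szego_dual_circle cnj_power_mult_power mult.assoc[symmetric] simp del: complex_cnj_power)
  also have "\<dots> = 0" using assms(2-4) by (simp add: szego_orth_def del: complex_cnj_mult)
  finally show ?thesis .
qed

text \<open>This is the inverse recursion \<open>(1 - |a\<^sub>n|\<^sup>2) w \<Phi>\<^sub>n =
  \<Phi>\<^sub>n\<^sub>+\<^sub>1 + cnj a\<^sub>n \<Phi>\<^sub>n\<^sub>+\<^sub>1\<^sup>*\<close>.
  Testing against \<open>w^(k+1)\<close> absorbs the factor \<open>w\<close>, and both terms on the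
  right then integrate to zero.\<close>

lemma szego_orth_Suc_imp:
  assumes mu: "circle_prob_measure \<mu>" and "szego_orth \<mu> a (Suc n)" and a: "cmod (a n) < 1"
  shows "szego_orth \<mu> a n"
  unfolding szego_orth_def
proof (intro allI impI)
  fix k assume k: "k < n"
  define r where "r = 1 - cnj (a n) * a n"
  have "r = of_real (1 - (cmod (a n))\<^sup>2)"
    unfolding r_def of_real_diff complex_norm_square by (simp add: mult.commute)
  moreover have "(cmod (a n))\<^sup>2 < 1" using a by (simp add: abs_square_less_1)
  ultimately have r: "r \<noteq> 0" by (simp del: of_real_diff of_real_power)
  note int = circle_prob_measure_integrable[OF mu]
  let ?p = "\<lambda>w. cnj (w ^ Suc k) * poly (szego a (Suc n)) w"
  let ?q = "\<lambda>w. cnj (w ^ Suc k) * poly (szego_dual a (Suc n)) w"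
  have "r * (LINT w|\<mu>. cnj (w ^ k) * poly (szego a n) w) = (LINT w|\<mu>. r * (cnj (w ^ k) * poly (szego a n) w))"
    by simp
  also have "\<dots> = (LINT w|\<mu>. ?p w + cnj (a n) * ?q w)"
  proof (intro circle_integral_cong[OF mu])
    fix w :: complex assume "cmod w = 1"
    hence w: "cnj w * w = 1" using cnj_mult_cmod_1 by blast
    have "?p w + cnj (a n) * ?q w = (cnj w * w) * r * (cnj (w ^ k) * poly (szego a n) w)"
      by (simp add: r_def algebra_simps)
    thus "r * (cnj (w ^ k) * poly (szego a n) w) = ?p w + cnj (a n) * ?q w" using w by simp
  qed
  also have "\<dots> = (LINT w|\<mu>. ?p w) + cnj (a n) * (LINT w|\<mu>. ?q w)"
    by (subst Bochner_Integration.integral_add)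
       (auto intro!: int continuous_intros simp del: szego.simps szego_dual.simps power_Suc)
  also have "\<dots> = 0"
    using assms(2) k circle_integral_szego_dual[OF mu assms(2), of "Suc k"]
    by (simp add: szego_orth_def del: szego.simps szego_dual.simps power_Suc)
  finally show "(LINT w|\<mu>. cnj (w ^ k) * poly (szego a n) w) = 0" using r by simp
qed

lemma circle_integral_cnj_poly_szego:
  assumes mu: "circle_prob_measure \<mu>" and o: "szego_orth \<mu> a n" and q: "degree q \<le> n"
  shows "(LINT w|\<mu>. cnj (poly q w) * poly (szego a n) w)
       = cnj (coeff q n) * (LINT w|\<mu>. (cmod (poly (szego a n) w))\<^sup>2)"
proof -
  have poly_q: "poly q w = (\<Sum>k\<le>n. coeff q k * w ^ k)" if "degree q \<le> n" for q :: "complex poly" and w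
    unfolding poly_altdef using that by (intro sum.mono_neutral_left) (auto simp: coeff_eq_0)
  have *: "(LINT w|\<mu>. cnj (poly q w) * poly (szego a n) w)
       = cnj (coeff q n) * (LINT w|\<mu>. cnj (w ^ n) * poly (szego a n) w)"
    if q: "degree q \<le> n" for q
  proof -
    have "(LINT w|\<mu>. cnj (poly q w) * poly (szego a n) w)
        = (LINT w|\<mu>. (\<Sum>k\<le>n. cnj (coeff q k) * (cnj (w ^ k) * poly (szego a n) w)))"
      by (simp add: poly_q[OF q] sum_distrib_right mult.assoc)
    also have "\<dots> = (\<Sum>k\<le>n. cnj (coeff q k) * (LINT w|\<mu>. cnj (w ^ k) * poly (szego a n) w))"
      by (subst Bochner_Integration.integral_sum)
         (auto intro!: circle_prob_measure_integrable[OF mu] continuous_intros)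
    also have "\<dots> = (\<Sum>k\<in>{n}. cnj (coeff q k) * (LINT w|\<mu>. cnj (w ^ k) * poly (szego a n) w))"
      using o by (intro sum.mono_neutral_right) (auto simp: szego_orth_def)
    finally show ?thesis by simp
  qed
  \<comment> \<open>Applying the previous identity to the monic polynomial \<open>szego a n\<close>
    itself identifies the one surviving integral as its squared norm.\<close>
  have "(LINT w|\<mu>. cnj (w ^ n) * poly (szego a n) w) = (LINT w|\<mu>. cnj (poly (szego a n) w) * poly (szego a n) w)"
    using *[of "szego a n"] by simp
  also have "\<dots> = (LINT w|\<mu>. of_real ((cmod (poly (szego a n) w))\<^sup>2))"
    by (simp only: complex_norm_square mult.commute)
  also have "\<dots> = of_real (LINT w|\<mu>. (cmod (poly (szego a n) w))\<^sup>2)"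
    by (rule integral_complex_of_real)
  finally show ?thesis using *[OF q] by simp
qed

text \<open>Pythagoras for \<open>w \<Phi>\<^sub>n = \<Phi>\<^sub>n\<^sub>+\<^sub>1 + cnj a\<^sub>n
  \<Phi>\<^sub>n\<^sup>*\<close>: the summands are orthogonal because
  \<open>\<Phi>\<^sub>n\<^sup>*\<close> has degree at most \<open>n\<close>, and
  \<open>|\<Phi>\<^sub>n\<^sup>*| = |\<Phi>\<^sub>n|\<close> on the circle.\<close>

lemma norm_szego_Suc:
  assumes mu: "circle_prob_measure \<mu>" and o: "szego_orth \<mu> a (Suc n)"
  shows "(LINT w|\<mu>. (cmod (poly (szego a (Suc n)) w))\<^sup>2)
       = (1 - (cmod (a n))\<^sup>2) * (LINT w|\<mu>. (cmod (poly (szego a n) w))\<^sup>2)"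
proof -
  let ?P = "poly (szego a (Suc n))" and ?p = "poly (szego a n)" and ?q = "poly (szego_dual a n)"
  note int = circle_prob_measure_integrable[OF mu]
  have z: "(LINT w|\<mu>. cnj (cnj (a n) * ?q w) * ?P w) = 0"
    using circle_integral_cnj_poly_szego[OF mu o, of "smult (cnj (a n)) (szego_dual a n)"] degree_szego_dual[of a n]
    by (simp add: coeff_eq_0 le_SucI del: szego.simps)
  have "(LINT w|\<mu>. (cmod (?p w))\<^sup>2)
      = (LINT w|\<mu>. (cmod (?P w))\<^sup>2 + (cmod (a n))\<^sup>2 * (cmod (?p w))\<^sup>2 + 2 * Re (cnj (cnj (a n) * ?q w) * ?P w))"
  proof (intro circle_integral_cong[OF mu])
    fix w :: complex assume w: "cmod w = 1"
    have e: "w * ?p w = ?P w + cnj (a n) * ?q w" by simp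
    have "(cmod (?p w))\<^sup>2 = (cmod (w * ?p w))\<^sup>2" using w by (simp add: norm_mult)
    also have "\<dots> = (cmod (?P w))\<^sup>2 + (cmod (cnj (a n) * ?q w))\<^sup>2 + 2 * Re (cnj (cnj (a n) * ?q w) * ?P w)"
      unfolding e cmod_power2 by (simp add: power2_eq_square algebra_simps del: szego.simps)
    also have "(cmod (cnj (a n) * ?q w))\<^sup>2 = (cmod (a n))\<^sup>2 * (cmod (?p w))\<^sup>2"
      using w by (simp add: szego_dual_circle norm_mult norm_power power_mult_distrib)
    finally show "(cmod (?p w))\<^sup>2 = (cmod (?P w))\<^sup>2 + (cmod (a n))\<^sup>2 * (cmod (?p w))\<^sup>2 + 2 * Re (cnj (cnj (a n) * ?q w) * ?P w)" .
  qed
  also have "\<dots> = (LINT w|\<mu>. (cmod (?P w))\<^sup>2) + (cmod (a n))\<^sup>2 * (LINT w|\<mu>. (cmod (?p w))\<^sup>2)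
      + 2 * (LINT w|\<mu>. Re (cnj (cnj (a n) * ?q w) * ?P w))"
    by (subst Bochner_Integration.integral_add Bochner_Integration.integral_mult_right_zero;
        (intro int continuous_intros)?)+ simp
  also have "(LINT w|\<mu>. Re (cnj (cnj (a n) * ?q w) * ?P w)) = Re (LINT w|\<mu>. cnj (cnj (a n) * ?q w) * ?P w)"
    by (intro integral_Re int continuous_intros)
  also have "\<dots> = 0" by (simp only: z zero_complex.sel)
  finally show ?thesis by (simp only: left_diff_distrib)
qed

lemma norm_szego:
  assumes mu: "circle_prob_measure \<mu>" and o: "\<And>n. szego_orth \<mu> a n"
  shows "(LINT w|\<mu>. (cmod (poly (szego a n) w))\<^sup>2) = (\<Prod>j<n. 1 - (cmod (a j))\<^sup>2)"
proof (induction n)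
  case 0
  interpret prob_space \<mu> using circle_prob_measureD mu by blast
  show ?case by (simp add: prob_space)
next
  case (Suc n)
  thus ?case using norm_szego_Suc[OF mu o] by (simp add: mult.commute del: szego.simps)
qed

section \<open>Verblunsky coefficients\<close>

lemma nontrivial_circle_measureD:
  "nontrivial_circle_measure \<mu> \<Longrightarrow> circle_prob_measure \<mu>"
  by (simp add: nontrivial_circle_measure_def)

lemma circle_finite_measurable:
  assumes "circle_prob_measure \<mu>" "finite S" "S \<subseteq> sphere 0 1"
  shows "S \<in> sets \<mu>"
  unfolding circle_prob_measureD(3)[OF assms(1)] sets_restrict_space image_def
  using assms(2,3) by (auto intro!: bexI[of _ S] borel_closed finite_imp_closed)

text \<open>A vanishing norm would concentrate \<mu> on the finitely many zeros of \<open>p\<close>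
  on the circle, making it a finite sum of point masses.\<close>

lemma nontrivial_norm_poly_pos:
  assumes nt: "nontrivial_circle_measure \<mu>" and p: "p \<noteq> 0"
  shows "(LINT w|\<mu>. (cmod (poly p w))\<^sup>2) > 0"
proof (rule ccontr)
  note mu = nontrivial_circle_measureD[OF nt]
  interpret prob_space \<mu> using circle_prob_measureD mu by blast
  assume "\<not> ?thesis"
  moreover have "(LINT w|\<mu>. (cmod (poly p w))\<^sup>2) \<ge> 0" by simp
  ultimately have "(LINT w|\<mu>. (cmod (poly p w))\<^sup>2) = 0" by linarith
  moreover have "integrable \<mu> (\<lambda>w. (cmod (poly p w))\<^sup>2)"
    by (intro circle_prob_measure_integrable[OF mu] continuous_intros)
  ultimately have ae: "AE w in \<mu>. (cmod (poly p w))\<^sup>2 = 0"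
    by (subst (asm) integral_nonneg_eq_0_iff_AE) auto
  define S where "S = {w \<in> sphere 0 1. poly p w = 0}"
  have S: "finite S" "S \<subseteq> sphere 0 1"
    unfolding S_def using poly_roots_finite[OF p] by auto
  have aeS: "AE w in \<mu>. w \<in> S"
    using ae AE_space by eventually_elim (auto simp: S_def circle_prob_measureD(2)[OF mu])
  have sing: "T \<in> sets \<mu>" if "T \<subseteq> S" for T
    using that S by (intro circle_finite_measurable[OF mu]) (auto intro: finite_subset)
  have "measure \<mu> E = (\<Sum>w\<in>S. measure \<mu> {w} * measure (return \<mu> w) E)" if E: "E \<in> sets \<mu>" for E
  proof -
    have "measure \<mu> E = measure \<mu> (E \<inter> S)"
      using aeS E sing by (intro finite_measure_eq_AE) auto
    also have "\<dots> = (\<Sum>w\<in>E \<inter> S. measure \<mu> {w})"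
      using S sing by (intro finite_measure_eq_sum_singleton) auto
    also have "\<dots> = (\<Sum>w\<in>S. measure \<mu> {w} * measure (return \<mu> w) E)"
    proof (intro sum.mono_neutral_cong_left)
      show "\<forall>w\<in>S - E \<inter> S. measure \<mu> {w} * measure (return \<mu> w) E = 0"
        using E by (auto simp: measure_def indicator_def)
      show "measure \<mu> {w} = measure \<mu> {w} * measure (return \<mu> w) E" if "w \<in> E \<inter> S" for w
        using E that by (auto simp: measure_def)
    qed (use S in auto)
    finally show ?thesis .
  qed
  hence "\<exists>S c. finite S \<and> S \<subseteq> sphere 0 1 \<and>
      (\<forall>E\<in>sets \<mu>. measure \<mu> E = (\<Sum>w\<in>S. c w * measure (return \<mu> w) E))"
    using S by (intro exI[of _ S] exI[of _ "\<lambda>w. measure \<mu> {w}"] conjI ballI)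
  with nt show False
    unfolding nontrivial_circle_measure_def by (elim conjE notE)
qed

text \<open>If \<mu> lived on a finite set \<open>S\<close>, the monic polynomial with zero set
  \<open>S\<close> would vanish almost everywhere. Pairing it with \<open>szego a (card S)\<close>
  would make the squared norm of the latter zero, against the product formula.\<close>

lemma szego_orth_imp_nontrivial:
  assumes mu: "circle_prob_measure \<mu>" and o: "\<And>n. szego_orth \<mu> a n" and a: "\<And>n. cmod (a n) < 1"
  shows "nontrivial_circle_measure \<mu>"
  unfolding nontrivial_circle_measure_def
proof (intro conjI mu notI, elim exE conjE)
  fix S and c :: "complex \<Rightarrow> real"
  assume S: "finite S" "S \<subseteq> sphere 0 1"
    and c: "\<forall>E\<in>sets \<mu>. measure \<mu> E = (\<Sum>w\<in>S. c w * measure (return \<mu> w) E)"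
  interpret prob_space \<mu> using circle_prob_measureD mu by blast
  have Sm: "S \<in> sets \<mu>" using circle_finite_measurable[OF mu S] .
  define q where "q = (\<Prod>s\<in>S. [:- s, 1:])"
  have "lead_coeff q = 1" unfolding q_def lead_coeff_prod by simp
  moreover have "degree q = card S"
    unfolding q_def by (subst degree_prod_eq_sum_degree) auto
  ultimately have q: "degree q = card S" "coeff q (card S) = 1" "\<And>w. w \<in> S \<Longrightarrow> poly q w = 0"
    using S(1) by (auto simp: q_def poly_prod)
  have "measure \<mu> (space \<mu> - S) = (\<Sum>w\<in>S. c w * measure (return \<mu> w) (space \<mu> - S))"
    using c Sm by auto
  also have "\<dots> = 0"
    using Sm by (intro sum.neutral) (auto simp: measure_def)
  finally have "AE w in \<mu>. w \<in> S"
    using Sm by (subst AE_iff_measurable[of "space \<mu> - S"]) (auto simp: emeasure_eq_measure)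
  hence "(LINT w|\<mu>. cnj (poly q w) * poly (szego a (card S)) w) = (LINT w|\<mu>. 0)"
    by (intro integral_cong_AE borel_measurable_continuous_onI circle_prob_measure_borel_measurable[OF mu]
        continuous_intros) (auto elim!: eventually_mono simp: q)
  hence "(LINT w|\<mu>. (cmod (poly (szego a (card S)) w))\<^sup>2) = 0"
    using circle_integral_cnj_poly_szego[OF mu o, of q "card S"] q by auto
  hence "(\<Prod>j<card S. 1 - (cmod (a j))\<^sup>2) = 0" using norm_szego[OF mu o] by simp
  then obtain j where "(cmod (a j))\<^sup>2 = 1"
    unfolding prod_zero_iff[OF finite_lessThan] by force
  moreover have "(cmod (a j))\<^sup>2 < 1" using a[of j] by (simp add: abs_square_less_1)
  ultimately show False by linarith
qed

lemma monic_op_eq_szego: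
  assumes nt: "nontrivial_circle_measure \<mu>" and o: "szego_orth \<mu> a n"
  shows "monic_op \<mu> n = szego a n"
  unfolding monic_op_def
proof (rule the_equality)
  note mu = nontrivial_circle_measureD[OF nt]
  have *: "\<forall>q. degree q < n \<longrightarrow> (LINT w|\<mu>. cnj (poly q w) * poly (szego a n) w) = 0"
    using circle_integral_cnj_poly_szego[OF mu o] by (simp add: coeff_eq_0)
  thus "degree (szego a n) = n \<and> lead_coeff (szego a n) = 1 \<and>
        (\<forall>q. degree q < n \<longrightarrow> (LINT w|\<mu>. cnj (poly q w) * poly (szego a n) w) = 0)" by simp
  fix p assume p: "degree p = n \<and> lead_coeff p = 1 \<and>
        (\<forall>q. degree q < n \<longrightarrow> (LINT w|\<mu>. cnj (poly q w) * poly p w) = 0)"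
  show "p = szego a n"
  proof (rule ccontr)
    assume ne: "p \<noteq> szego a n"
    \<comment> \<open>The leading terms cancel, so \<open>d\<close> is itself an admissible test
      polynomial; it is orthogonal to both \<open>p\<close> and \<open>szego a n\<close>, hence to
      itself.\<close>
    define d where "d = p - szego a n"
    have "degree d \<le> n" using p by (auto simp: d_def intro!: degree_diff_le)
    moreover have "coeff d n = 0" using p by (auto simp: d_def)
    moreover have d0: "d \<noteq> 0" using ne by (simp add: d_def)
    ultimately have dd: "degree d < n"
      by (metis le_neq_implies_less leading_coeff_0_iff)
    have "(LINT w|\<mu>. of_real ((cmod (poly d w))\<^sup>2)) = (LINT w|\<mu>. cnj (poly d w) * poly p w - cnj (poly d w) * poly (szego a n) w)"
      by (intro circle_integral_cong[OF mu]) (simp only: complex_norm_square, simp add: d_def algebra_simps)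
    also have "\<dots> = (LINT w|\<mu>. cnj (poly d w) * poly p w) - (LINT w|\<mu>. cnj (poly d w) * poly (szego a n) w)"
      by (intro Bochner_Integration.integral_diff circle_prob_measure_integrable[OF mu] continuous_intros)
    also have "\<dots> = 0" using p * dd by simp
    finally have "(LINT w|\<mu>. (cmod (poly d w))\<^sup>2) = 0"
      unfolding integral_complex_of_real by simp
    thus False using nontrivial_norm_poly_pos[OF nt d0] by simp
  qed
qed

lemma szego_szego_dual_cong:
  "(\<And>j. j < n \<Longrightarrow> a j = b j) \<Longrightarrow> szego a n = szego b n \<and> szego_dual a n = szego_dual b n"
  by (induction n) auto

text \<open>Szego's theorem: the orthogonal polynomials obey the recursion with their own Verblunsky
  coefficients. The next coefficient is first chosen to force orthogonality and only afterwards
  recognised as \<open>verblunsky \<mu> n\<close>.\<close>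

lemma szego_orth_verblunsky:
  assumes nt: "nontrivial_circle_measure \<mu>"
  shows "szego_orth \<mu> (verblunsky \<mu>) n"
proof (induction n)
  case 0
  show ?case by (simp add: szego_orth_def)
next
  case (Suc n)
  note mu = nontrivial_circle_measureD[OF nt]
  note int = circle_prob_measure_integrable[OF mu]
  define a where "a = verblunsky \<mu>"
  have o: "szego_orth \<mu> a n" using Suc by (simp add: a_def)
  let ?p = "poly (szego a n)" and ?q = "poly (szego_dual a n)"
  have "(LINT w|\<mu>. (cmod (?p w))\<^sup>2) > 0"
    by (rule nontrivial_norm_poly_pos[OF nt szego_nonzero])
  moreover have "(LINT w|\<mu>. ?q w) = of_real (LINT w|\<mu>. (cmod (?p w))\<^sup>2)"
  proof -
    have "(LINT w|\<mu>. ?q w) = (LINT w|\<mu>. cnj (cnj (w ^ n) * ?p w))"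
      by (intro circle_integral_cong[OF mu]) (simp add: szego_dual_circle)
    also have "\<dots> = cnj (LINT w|\<mu>. cnj (poly (monom 1 n) w) * ?p w)"
      by (simp add: poly_monom del: complex_cnj_mult)
    also have "\<dots> = of_real (LINT w|\<mu>. (cmod (?p w))\<^sup>2)"
      by (subst circle_integral_cnj_poly_szego[OF mu o]) (auto simp: degree_monom_eq)
    finally show ?thesis .
  qed
  ultimately have q0: "(LINT w|\<mu>. ?q w) \<noteq> 0" by auto
  \<comment> \<open>Chosen to give orthogonality to constants. For the powers from 1 to
    \<open>n\<close> both integrals vanish whatever the coefficient is.\<close>
  define c where "c = (LINT w|\<mu>. w * ?p w) / (LINT w|\<mu>. ?q w)"
  \<comment> \<open>Only entry \<open>n\<close> is overwritten, so the polynomials up to degree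
    \<open>n\<close> stay the same.\<close>
  define b where "b = a(n := cnj c)"
  have sz: "szego b n = szego a n" "szego_dual b n = szego_dual a n"
    using szego_szego_dual_cong[of n b a] by (auto simp: b_def)
  have bn: "b n = cnj c" by (simp add: b_def)
  have ob: "szego_orth \<mu> b (Suc n)"
    unfolding szego_orth_def
  proof (intro allI impI)
    fix k assume k: "k < Suc n"
    have "(LINT w|\<mu>. cnj (w ^ k) * poly (szego b (Suc n)) w)
        = (LINT w|\<mu>. cnj (w ^ k) * (w * ?p w) - c * (cnj (w ^ k) * ?q w))"
      by (simp add: sz bn algebra_simps)
    also have "\<dots> = (LINT w|\<mu>. cnj (w ^ k) * (w * ?p w)) - c * (LINT w|\<mu>. cnj (w ^ k) * ?q w)"
      by (subst Bochner_Integration.integral_diff) (auto intro!: int continuous_intros)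
    also have "\<dots> = 0"
    proof (cases k)
      case 0
      thus ?thesis using q0 by (simp add: c_def)
    next
      case (Suc j)
      have "(LINT w|\<mu>. cnj (w ^ k) * (w * ?p w)) = (LINT w|\<mu>. cnj (w ^ j) * ?p w)"
      proof (intro circle_integral_cong[OF mu])
        fix w :: complex assume "cmod w = 1"
        hence w: "cnj w * w = 1" using cnj_mult_cmod_1 by blast
        have "cnj (w ^ k) * (w * ?p w) = (cnj w * w) * (cnj (w ^ j) * ?p w)"
          by (simp add: Suc)
        thus "cnj (w ^ k) * (w * ?p w) = cnj (w ^ j) * ?p w" using w by simp
      qed
      also have "\<dots> = 0" using o Suc k by (simp add: szego_orth_def)
      finally show ?thesis
        using circle_integral_szego_dual[OF mu o, of k] Suc k by simp
    qed
    finally show "(LINT w|\<mu>. cnj (w ^ k) * poly (szego b (Suc n)) w) = 0" .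
  qed
  \<comment> \<open>The new polynomial is now known to be \<open>monic_op \<mu> (Suc n)\<close>; its
    value at 0 returns the chosen coefficient, so nothing was actually overwritten.\<close>
  have "a n = cnj c"
    unfolding a_def verblunsky_def monic_op_eq_szego[OF nt ob] by (simp add: bn)
  hence ba: "b = a" unfolding b_def by (rule fun_upd_idem)
  show ?case using ob[unfolded ba a_def] .
qed

lemma monic_op_verblunsky:
  "nontrivial_circle_measure \<mu> \<Longrightarrow> monic_op \<mu> n = szego (verblunsky \<mu>) n"
  by (rule monic_op_eq_szego[OF _ szego_orth_verblunsky])

lemma cmod_verblunsky_less_1:
  assumes nt: "nontrivial_circle_measure \<mu>"
  shows "cmod (verblunsky \<mu> n) < 1"
proof -
  note mu = nontrivial_circle_measureD[OF nt]
  define I where "I n = (LINT w|\<mu>. (cmod (poly (szego (verblunsky \<mu>) n) w))\<^sup>2)" for n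
  have I: "I n > 0" for n
    unfolding I_def by (rule nontrivial_norm_poly_pos[OF nt szego_nonzero])
  have "I (Suc n) = (1 - (cmod (verblunsky \<mu> n))\<^sup>2) * I n"
    unfolding I_def by (rule norm_szego_Suc[OF mu szego_orth_verblunsky[OF nt]])
  moreover have "I (Suc n) > 0" "I n > 0" by (rule I)+
  ultimately have "1 - (cmod (verblunsky \<mu> n))\<^sup>2 > 0" by (metis less_not_sym zero_less_mult_iff)
  thus ?thesis by (simp add: abs_square_less_1)
qed

lemma verblunsky_eqI:
  assumes nt: "nontrivial_circle_measure \<mu>" and o: "\<And>n. szego_orth \<mu> a n"
  shows "verblunsky \<mu> n = a n"
  unfolding verblunsky_def monic_op_eq_szego[OF nt o] by simp

section \<open>Normalisation of the orthogonal polynomials\<close>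

text \<open>For a measure with coefficients \<open>a\<close> this is the norm of
  \<open>\<Phi>\<^sub>n\<close>. Expressed through \<open>a\<close> alone, it makes sense for
  \<open>-a\<close> without a second measure.\<close>

definition szego_norm :: "(nat \<Rightarrow> complex) \<Rightarrow> nat \<Rightarrow> real" where
  "szego_norm a n = (\<Prod>j<n. sqrt (1 - (cmod (a j))\<^sup>2))"

lemma szego_norm_0 [simp]: "szego_norm a 0 = 1"
  and szego_norm_Suc: "szego_norm a (Suc n) = szego_norm a n * sqrt (1 - (cmod (a n))\<^sup>2)"
  by (simp_all add: szego_norm_def)

lemma szego_norm_pos: "(\<And>n. cmod (a n) < 1) \<Longrightarrow> szego_norm a n > 0"
  unfolding szego_norm_def by (intro prod_pos) (simp add: abs_square_less_1)

lemma szego_norm_power2: "(\<And>n. cmod (a n) < 1) \<Longrightarrow> (szego_norm a n)\<^sup>2 = (\<Prod>j<n. 1 - (cmod (a j))\<^sup>2)"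
  unfolding szego_norm_def prod_power_distrib
  by (intro prod.cong refl real_sqrt_pow2) (simp add: abs_square_le_1 less_imp_le)

lemma orthonormal_op_verblunsky:
  assumes nt: "nontrivial_circle_measure \<mu>"
  shows "orthonormal_op \<mu> n = smult (of_real (1 / szego_norm (verblunsky \<mu>) n)) (szego (verblunsky \<mu>) n)"
proof -
  note mu = nontrivial_circle_measureD[OF nt]
  have a: "\<And>n. cmod (verblunsky \<mu> n) < 1" using cmod_verblunsky_less_1[OF nt] .
  have "szego_norm (verblunsky \<mu>) n = sqrt (LINT w|\<mu>. (cmod (poly (szego (verblunsky \<mu>) n) w))\<^sup>2)"
    unfolding norm_szego[OF mu szego_orth_verblunsky[OF nt]]
    using szego_norm_power2[of "verblunsky \<mu>" n, OF a] szego_norm_pos[of "verblunsky \<mu>" n, OF a]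
    by (intro real_sqrt_unique[symmetric] less_imp_le)
  thus ?thesis by (simp add: orthonormal_op_def monic_op_verblunsky[OF nt])
qed

section \<open>Existence in Verblunsky's theorem\<close>

lemma circle_mean_value:
  assumes "continuous_on (cball 0 1) f" "f holomorphic_on ball 0 1"
  shows "((\<lambda>t. f (cis t)) has_integral 2 * of_real pi * f 0) {0..2 * pi}"
proof -
  have "((\<lambda>u. f u / (u - 0)) has_contour_integral (2 * of_real pi * \<i> * f 0)) (circlepath 0 1)"
    using assms by (intro Cauchy_integral_circlepath) auto
  hence "((\<lambda>t. f (0 + of_real 1 * cis t) / (0 + of_real 1 * cis t - 0) * of_real 1 * \<i> * cis t)
      has_integral (2 * of_real pi * \<i> * f 0)) {0..2 * pi}"
    unfolding circlepath_def by (subst (asm) has_contour_integral_part_circlepath_iff) auto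
  hence "((\<lambda>t. f (cis t) * \<i>) has_integral (2 * of_real pi * \<i> * f 0)) {0..2 * pi}"
    by simp
  hence "((\<lambda>t. f (cis t) * \<i> / \<i>) has_integral (2 * of_real pi * \<i> * f 0) / \<i>) {0..2 * pi}"
    by (rule has_integral_divide)
  moreover have "f (cis t) * \<i> / \<i> = f (cis t)" "(2 * of_real pi * \<i> * f 0) / \<i> = 2 * of_real pi * f 0" for t
    by (simp_all add: field_simps)
  ultimately show ?thesis by (simp only:)
qed

text \<open>Representing circle measures as images of distributions on the line makes tightness and
  weak compactness on the line applicable.\<close>

definition circle_distr :: "real measure \<Rightarrow> complex measure" where
  "circle_distr M = distr M (restrict_space borel (sphere 0 1)) cis"

lemma continuous_on_cis [continuous_intros]:
  "continuous_on A f \<Longrightarrow> continuous_on A (\<lambda>x. cis (f x))"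
  unfolding cis_conv_exp by (intro continuous_intros)

lemma measurable_cis_circle:
  assumes "real_distribution M"
  shows "cis \<in> measurable M (restrict_space borel (sphere 0 1))"
proof -
  interpret real_distribution M by fact
  have "cis \<in> measurable borel (restrict_space borel (sphere 0 1))"
    by (intro measurable_restrict_space2 borel_measurable_continuous_onI continuous_intros) auto
  thus ?thesis by (simp cong: measurable_cong_sets)
qed

lemma circle_prob_measure_circle_distr:
  assumes "real_distribution M"
  shows "circle_prob_measure (circle_distr M)"
proof -
  interpret real_distribution M by fact
  show ?thesis unfolding circle_prob_measure_def circle_distr_def
    using measurable_cis_circle[OF assms] by (auto intro!: prob_space_distr)
qed

lemma integral_circle_distr:
  fixes f :: "complex \<Rightarrow> complex"
  assumes "real_distribution M" "continuous_on (sphere 0 1) f"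
  shows "integral\<^sup>L (circle_distr M) f = (LINT t|M. f (cis t))"
  unfolding circle_distr_def
  by (intro integral_distr measurable_cis_circle assms(1) borel_measurable_continuous_on_restrict assms(2))

text \<open>The normalised density \<open>|\<Phi>\<^sub>N|\<^sup>-\<^sup>2\<close> works because on the circle \<open>cnj (w\<^sup>k) / cnj \<Phi>\<^sub>N(w)\<close> is
  \<open>w\<^bsup>N-k\<^esup> / \<Phi>\<^sub>N\<^sup>*(w)\<close>, which is analytic in the disk and vanishes at 0 for \<open>k < N\<close>. The interval
  \<open>{-1<..7}\<close> is just one that contains \<open>[0, 2\<pi>]\<close>.\<close>

lemma bernstein_szego:
  assumes a: "\<And>n. cmod (a n) < 1"
  obtains M where "real_distribution M" "measure M {-1<..7} = 1" "\<And>n. n \<le> N \<Longrightarrow> szego_orth (circle_distr M) a n"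
proof -
  let ?P = "poly (szego a N)" and ?Q = "poly (szego_dual a N)"
  have P0: "?P w \<noteq> 0" if "cmod w = 1" for w
    using szego_dual_nonzero[of a w N, OF a] szego_dual_circle[OF that, of a N] that by auto
  define g where "g t = indicator {0..2 * pi} t * inverse ((cmod (?P (cis t)))\<^sup>2)" for t :: real
  define Z where "Z = (LINT t|lborel. g t)"
  have gI: "g t = indicator {0..2 * pi} t *\<^sub>R inverse ((cmod (?P (cis t)))\<^sup>2)" for t by (simp add: g_def)
  have cont: "continuous_on {0..2 * pi} (\<lambda>t. inverse ((cmod (?P (cis t)))\<^sup>2))"
    using P0 by (intro continuous_intros) auto
  have g_int: "integrable lborel g"
    using borel_integrable_atLeastAtMost'[OF cont] unfolding set_integrable_def gI[abs_def] .
  have g_meas [measurable]: "g \<in> borel_measurable borel"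
    using borel_measurable_integrable[OF g_int] by simp
  have g_nonneg: "0 \<le> g t" for t by (simp add: g_def)
  \<comment> \<open>The density is strictly positive on the whole of \<open>{0..2 * pi}\<close>, an
    interval of positive length, so it can be normalised.\<close>
  have "Z \<noteq> 0"
  proof
    assume "Z = 0"
    hence "AE t in lborel. g t = 0"
      unfolding Z_def using integral_nonneg_eq_0_iff_AE[OF g_int] g_nonneg by simp
    hence "AE t in lborel. t \<notin> {0..2 * pi}"
      by eventually_elim (use P0 in \<open>auto simp: g_def indicator_def split: if_splits\<close>)
    hence "emeasure lborel {0..2 * pi} = 0"
      by (subst (asm) AE_iff_measurable[of "{0..2 * pi}"]) auto
    thus False by simp
  qed
  moreover have "Z \<ge> 0" unfolding Z_def using g_nonneg by simp
  ultimately have Z: "Z > 0" by simp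
  define M where "M = density lborel (\<lambda>t. ennreal (g t / Z))"
  have int_M: "integral\<^sup>L M f = (LINT t|lborel. (g t / Z) *\<^sub>R f t)"
    if "f \<in> borel_measurable borel" for f :: "real \<Rightarrow> complex"
    unfolding M_def using that g_nonneg Z by (intro integral_density) auto
  have "emeasure M (space M) = (\<integral>\<^sup>+ t. ennreal (g t / Z) \<partial>lborel)"
    unfolding M_def by (subst emeasure_density) (auto intro!: nn_integral_cong)
  also have "\<dots> = ennreal (LINT t|lborel. g t / Z)"
    using g_nonneg Z g_int by (intro nn_integral_eq_integral) auto
  also have "\<dots> = 1" using Z by (simp add: Z_def)
  finally have "prob_space M" by (rule prob_spaceI)
  hence rd: "real_distribution M"
    by (auto simp: real_distribution_def real_distribution_axioms_def M_def)
  interpret real_distribution M by fact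
  have "AE t in M. t \<in> {-1<..7}"
  proof -
    have "0 \<le> t \<and> t \<le> 2 * pi" if "g t / Z > 0" for t
      using that by (cases "t \<in> {0..2 * pi}") (auto simp: g_def)
    moreover have "2 * pi < 7" using pi_approx by simp
    ultimately show ?thesis
      unfolding M_def by (subst AE_density) (auto intro!: AE_I2 simp: ennreal_neg, force+)
  qed
  hence m1: "measure M {-1<..7} = 1" by (subst prob_eq_1) auto
  note mu = circle_prob_measure_circle_distr[OF rd]
  have oN: "szego_orth (circle_distr M) a N"
    unfolding szego_orth_def
  proof (intro allI impI)
    fix k assume k: "k < N"
    define f where "f w = w ^ (N - k) / ?Q w" for w
    have f_eq: "f w = cnj (w ^ k) * ?P w * of_real (inverse ((cmod (?P w))\<^sup>2))" if w: "cmod w = 1" for w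
    proof -
      have w0: "w \<noteq> 0" using w by auto
      have "f w * w ^ N * cnj (?P w) = w ^ (N - k)"
        unfolding f_def szego_dual_circle[OF w] using w0 P0[OF w] by simp
      also have "\<dots> = cnj (w ^ k) * w ^ N" using cnj_power_mult_power[OF w] k by simp
      finally have "f w * cnj (?P w) = cnj (w ^ k)" using w0 by simp
      moreover have "of_real (inverse ((cmod (?P w))\<^sup>2)) = inverse (?P w * cnj (?P w))"
        by (simp only: of_real_inverse complex_norm_square)
      ultimately show ?thesis using P0[OF w] by (simp add: field_simps)
    qed
    have Q0: "?Q w \<noteq> 0" if "cmod w \<le> 1" for w using szego_dual_nonzero[OF a that] .
    have hi: "((\<lambda>t. f (cis t)) has_integral 2 * of_real pi * f 0) {0..2 * pi}"
      unfolding f_def using Q0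
      by (intro circle_mean_value) (auto intro!: continuous_intros holomorphic_intros)
    have "f 0 = 0" using k by (simp add: f_def)
    have cf: "continuous_on {0..2 * pi} (\<lambda>t. f (cis t))"
      unfolding f_def using Q0 by (intro continuous_intros) auto
    have "(LINT t:{0..2 * pi}|lborel. f (cis t)) = integral {0..2 * pi} (\<lambda>t. f (cis t))"
      by (intro set_borel_integral_eq_integral borel_integrable_atLeastAtMost' cf)
    also have "\<dots> = 0" using hi \<open>f 0 = 0\<close> by (simp add: integral_unique)
    finally have I0: "(LINT t:{0..2 * pi}|lborel. f (cis t)) = 0" .
    have "(LINT w|circle_distr M. cnj (w ^ k) * ?P w) = (LINT t|M. cnj (cis t ^ k) * ?P (cis t))"
      by (intro integral_circle_distr rd continuous_intros)
    also have "\<dots> = (LINT t|lborel. (g t / Z) *\<^sub>R (cnj (cis t ^ k) * ?P (cis t)))"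
      by (intro int_M borel_measurable_continuous_onI continuous_intros)
    also have "\<dots> = (LINT t|lborel. (indicator {0..2 * pi} t *\<^sub>R f (cis t)) / of_real Z)"
      by (intro Bochner_Integration.integral_cong refl)
         (simp add: g_def f_eq scaleR_conv_of_real divide_inverse)
    also have "\<dots> = (LINT t:{0..2 * pi}|lborel. f (cis t)) / of_real Z"
      unfolding set_lebesgue_integral_def by simp
    finally show "(LINT w|circle_distr M. cnj (w ^ k) * ?P w) = 0" using I0 by simp
  qed
  \<comment> \<open>Orthogonality in the top degree \<open>N\<close> descends to all lower degrees
    by the inverse recursion.\<close>
  have "szego_orth (circle_distr M) a n" if "n \<le> N" for n
    using that
  proof (induction n rule: inc_induct)
    case base
    show ?case by (rule oN)
  next
    case (step n)
    thus ?case using szego_orth_Suc_imp[of _ a, OF mu _ a] by blast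
  qed
  with rd m1 show ?thesis using that by blast
qed

text \<open>Each orthogonality relation of degree \<open>n\<close> holds for all approximants with
  \<open>N \<ge> n\<close> and integrates a bounded continuous function, so it survives the weak
  limit. The relations then force the limit to be nontrivial and determine its coefficients.\<close>

theorem verblunsky_exists:
  assumes a: "\<And>n. cmod (a n) < 1"
  shows "\<exists>\<nu>. nontrivial_circle_measure \<nu> \<and> (\<forall>n. verblunsky \<nu> n = a n)"
proof -
  have "\<forall>N. \<exists>M. real_distribution M \<and> measure M {-1<..7} = 1 \<and> (\<forall>n\<le>N. szego_orth (circle_distr M) a n)"
    using bernstein_szego[of a, OF a] by blast
  from choice[OF this] obtain M where M: "\<And>N. real_distribution (M N)" "\<And>N. measure (M N) {-1<..7} = 1"
      "\<And>n N. n \<le> N \<Longrightarrow> szego_orth (circle_distr (M N)) a n"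
    by blast
  \<comment> \<open>All approximants put their full mass in one common interval.\<close>
  have "tight M"
    unfolding tight_def
  proof (intro conjI allI impI)
    fix \<epsilon> :: real assume "\<epsilon> > 0"
    hence "(-1::real) < 7 \<and> (\<forall>n. measure (M n) {-1<..7} > 1 - \<epsilon>)" using M(2) by simp
    thus "\<exists>a b. a < b \<and> (\<forall>n. measure (M n) {a<..b} > 1 - \<epsilon>)" by blast
  qed (rule M(1))
  \<comment> \<open>The compactness result starts from a subsequence of \<open>M\<close>; taking
    \<open>id\<close> gives a convergent subsequence of \<open>M\<close> itself.\<close>
  then obtain r M' where r: "strict_mono r" "real_distribution M'" "weak_conv_m (M \<circ> id \<circ> r) M'"
    using tight_imp_convergent_subsubsequence[of M id] strict_mono_id by blast
  have "szego_orth (circle_distr M') a n" for n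
    unfolding szego_orth_def
  proof (intro allI impI)
    fix k assume k: "k < n"
    define f where "f w = cnj (w ^ k) * poly (szego a n) w" for w
    have cf: "continuous_on A f" for A unfolding f_def by (intro continuous_intros)
    have "bounded (f ` sphere 0 1)"
      using cf by (intro compact_imp_bounded compact_continuous_image) auto
    then obtain B where B: "\<forall>x\<in>sphere 0 1. norm (f x) \<le> B" by (auto simp: bounded_iff)
    have "continuous_on UNIV (\<lambda>t. f (cis t))"
      by (intro continuous_on_compose2[OF cf[of UNIV]] continuous_intros) auto
    hence "(\<lambda>i. LINT t|(M \<circ> id \<circ> r) i. f (cis t)) \<longlonglongrightarrow> (LINT t|M'. f (cis t))"
      using B M(1) r by (intro weak_conv_imp_integral_bdd_continuous_conv[where B = B])
        (auto simp: continuous_on_eq_continuous_at o_def)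
    moreover have "\<forall>\<^sub>F i in sequentially. (LINT t|(M \<circ> id \<circ> r) i. f (cis t)) = 0"
      using eventually_ge_at_top[of n]
    proof eventually_elim
      case (elim i)
      hence "n \<le> r i" using seq_suble[OF r(1), of i] by linarith
      hence "integral\<^sup>L (circle_distr (M (r i))) f = 0" using M(3)[of n "r i"] k by (simp add: szego_orth_def f_def[abs_def])
      thus ?case using integral_circle_distr[OF M(1) cf] by simp
    qed
    hence "(\<lambda>i. LINT t|(M \<circ> id \<circ> r) i. f (cis t)) \<longlonglongrightarrow> 0"
      by (rule tendsto_eventually)
    ultimately have "(LINT t|M'. f (cis t)) = 0" by (rule LIMSEQ_unique)
    thus "(LINT w|circle_distr M'. cnj (w ^ k) * poly (szego a n) w) = 0"
      using integral_circle_distr[OF r(2) cf] unfolding f_def by simp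
  qed
  moreover from this have "nontrivial_circle_measure (circle_distr M')"
    by (intro szego_orth_imp_nontrivial[OF circle_prob_measure_circle_distr[OF r(2)] _ a])
  ultimately show ?thesis using verblunsky_eqI by blast
qed

section \<open>The square-summable solution inside the disk\<close>

text \<open>With the Verblunsky coefficients of \<mu> this is \<open>\<phi>\<^sub>n\<close>, with
  their negatives \<open>\<psi>\<^sub>n\<close>. Hence both are treated as solutions of recursions,
  and the second-kind measure is needed only in \<open>poly_second_kind_op\<close>.\<close>

definition orthonormal_szego :: "(nat \<Rightarrow> complex) \<Rightarrow> nat \<Rightarrow> complex \<Rightarrow> complex" where
  "orthonormal_szego a n z = poly (szego a n) z / of_real (szego_norm a n)"

definition orthonormal_dual :: "(nat \<Rightarrow> complex) \<Rightarrow> nat \<Rightarrow> complex \<Rightarrow> complex" where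
  "orthonormal_dual a n z = poly (szego_dual a n) z / of_real (szego_norm a n)"

lemma orthonormal_szego_0 [simp]: "orthonormal_szego a 0 z = 1" and orthonormal_dual_0 [simp]: "orthonormal_dual a 0 z = 1"
  by (simp_all add: orthonormal_szego_def orthonormal_dual_def)

lemma orthonormal_szego_orthonormal_dual_Suc:
  assumes a: "\<And>n. cmod (a n) < 1"
  shows "of_real (sqrt (1 - (cmod (a n))\<^sup>2)) * orthonormal_szego a (Suc n) z = z * orthonormal_szego a n z - cnj (a n) * orthonormal_dual a n z"
    and "of_real (sqrt (1 - (cmod (a n))\<^sup>2)) * orthonormal_dual a (Suc n) z = orthonormal_dual a n z - a n * z * orthonormal_szego a n z"
proof -
  have "(cmod (a n))\<^sup>2 < 1" using a[of n] by (simp add: abs_square_less_1)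
  hence *: "of_real (sqrt (1 - (cmod (a n))\<^sup>2)) * (x / (s * of_real (sqrt (1 - (cmod (a n))\<^sup>2)))) = x / s"
    for x s :: complex by simp
  show "of_real (sqrt (1 - (cmod (a n))\<^sup>2)) * orthonormal_szego a (Suc n) z = z * orthonormal_szego a n z - cnj (a n) * orthonormal_dual a n z"
    "of_real (sqrt (1 - (cmod (a n))\<^sup>2)) * orthonormal_dual a (Suc n) z = orthonormal_dual a n z - a n * z * orthonormal_szego a n z"
    unfolding orthonormal_szego_def orthonormal_dual_def szego_norm_Suc of_real_mult * by (simp_all add: diff_divide_distrib)
qed

lemma orthonormal_dual_circle: "cmod w = 1 \<Longrightarrow> orthonormal_dual a n w = w ^ n * cnj (orthonormal_szego a n w)"
  by (simp add: orthonormal_dual_def orthonormal_szego_def szego_dual_circle)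

lemma orthonormal_szego_wronskian:
  assumes a: "\<And>n. cmod (a n) < 1"
  shows "orthonormal_dual a n z * orthonormal_szego (\<lambda>k. - a k) n z + orthonormal_szego a n z * orthonormal_dual (\<lambda>k. - a k) n z = 2 * z ^ n"
proof (induction n)
  case (Suc n)
  define \<rho> where "\<rho> = complex_of_real (sqrt (1 - (cmod (a n))\<^sup>2))"
  let ?b = "\<lambda>k. - a k"
  have "(cmod (a n))\<^sup>2 < 1" using a[of n] by (simp add: abs_square_less_1)
  hence \<rho>0: "\<rho> \<noteq> 0" by (simp add: \<rho>_def)
  have \<rho>2: "\<rho> * \<rho> = 1 - a n * cnj (a n)"
    using \<open>(cmod (a n))\<^sup>2 < 1\<close> unfolding \<rho>_def complex_norm_square[symmetric] of_real_mult[symmetric]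
    by (simp del: of_real_mult)
  have r: "\<rho> * orthonormal_szego a (Suc n) z = z * orthonormal_szego a n z - cnj (a n) * orthonormal_dual a n z"
    "\<rho> * orthonormal_dual a (Suc n) z = orthonormal_dual a n z - a n * z * orthonormal_szego a n z"
    "\<rho> * orthonormal_szego ?b (Suc n) z = z * orthonormal_szego ?b n z + cnj (a n) * orthonormal_dual ?b n z"
    "\<rho> * orthonormal_dual ?b (Suc n) z = orthonormal_dual ?b n z + a n * z * orthonormal_szego ?b n z"
    using orthonormal_szego_orthonormal_dual_Suc[of a n z, OF a] orthonormal_szego_orthonormal_dual_Suc[of ?b n z] a by (simp_all add: \<rho>_def)
  have "(\<rho> * \<rho>) * (orthonormal_dual a (Suc n) z * orthonormal_szego ?b (Suc n) z + orthonormal_szego a (Suc n) z * orthonormal_dual ?b (Suc n) z)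
      = (\<rho> * orthonormal_dual a (Suc n) z) * (\<rho> * orthonormal_szego ?b (Suc n) z) + (\<rho> * orthonormal_szego a (Suc n) z) * (\<rho> * orthonormal_dual ?b (Suc n) z)"
    by (simp add: algebra_simps)
  also have "\<dots> = (1 - a n * cnj (a n)) * z * (orthonormal_dual a n z * orthonormal_szego ?b n z + orthonormal_szego a n z * orthonormal_dual ?b n z)"
    unfolding r by (simp add: algebra_simps)
  also have "\<dots> = (\<rho> * \<rho>) * (2 * z ^ Suc n)"
    unfolding Suc \<rho>2 by simp
  finally show ?case using \<rho>0 by simp
qed simp

text \<open>The Wronskian divided by \<open>z^n\<close>. It yields both
  \<open>|\<phi>\<^sub>n| |\<psi>\<^sub>n| \<ge> 1\<close> and the cancellation in the variation of
  parameters.\<close>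

lemma orthonormal_szego_second_kind_circle:
  assumes a: "\<And>n. cmod (a n) < 1" and z: "cmod z = 1"
  shows "cnj (orthonormal_szego a n z) * orthonormal_szego (\<lambda>k. - a k) n z + orthonormal_szego a n z * cnj (orthonormal_szego (\<lambda>k. - a k) n z) = 2"
proof -
  have "z ^ n * (cnj (orthonormal_szego a n z) * orthonormal_szego (\<lambda>k. - a k) n z + orthonormal_szego a n z * cnj (orthonormal_szego (\<lambda>k. - a k) n z)) = z ^ n * 2"
    using orthonormal_szego_wronskian[of a n z, OF a] by (simp add: orthonormal_dual_circle[OF z] algebra_simps)
  moreover have "z ^ n \<noteq> 0" using z by auto
  ultimately show ?thesis by (meson mult_left_cancel)
qed

lemma continuous_on_orthonormal_szego [continuous_intros]:
  "continuous_on A f \<Longrightarrow> continuous_on A (\<lambda>x. orthonormal_szego a n (f x))"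
  and continuous_on_orthonormal_dual [continuous_intros]:
  "continuous_on A f \<Longrightarrow> continuous_on A (\<lambda>x. orthonormal_dual a n (f x))"
  unfolding orthonormal_szego_def orthonormal_dual_def divide_inverse by (intro continuous_intros; assumption)+

lemma orthonormal_szego_orthonormal:
  assumes mu: "circle_prob_measure \<mu>" and o: "\<And>n. szego_orth \<mu> a n" and a: "\<And>n. cmod (a n) < 1"
  shows "(LINT w|\<mu>. cnj (orthonormal_szego a m w) * orthonormal_szego a n w) = of_bool (m = n)"
proof -
  have *: "(LINT w|\<mu>. cnj (orthonormal_szego a m w) * orthonormal_szego a n w) = of_bool (m = n)" if "m \<le> n" for m n
  proof -
    have "(LINT w|\<mu>. cnj (orthonormal_szego a m w) * orthonormal_szego a n w)
        = (LINT w|\<mu>. cnj (poly (szego a m) w) * poly (szego a n) w) / (of_real (szego_norm a m) * of_real (szego_norm a n))"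
      unfolding orthonormal_szego_def by (simp add: times_divide_times_eq)
    also have "\<dots> = cnj (coeff (szego a m) n) * of_real ((szego_norm a n)\<^sup>2) / (of_real (szego_norm a m) * of_real (szego_norm a n))"
      using circle_integral_cnj_poly_szego[OF mu o, of "szego a m" n] that
      by (simp add: norm_szego[OF mu o] szego_norm_power2[of a n, OF a])
    also have "\<dots> = of_bool (m = n)"
      using that szego_norm_pos[of a n, OF a] by (cases "m = n") (auto simp: coeff_eq_0 power2_eq_square)
    finally show ?thesis .
  qed
  show ?thesis
  proof (cases "m \<le> n")
    case False
    have "(LINT w|\<mu>. cnj (orthonormal_szego a m w) * orthonormal_szego a n w) = (LINT w|\<mu>. cnj (cnj (orthonormal_szego a n w) * orthonormal_szego a m w))"
      by (simp add: mult.commute)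
    also have "\<dots> = cnj (LINT w|\<mu>. cnj (orthonormal_szego a n w) * orthonormal_szego a m w)"
      by (rule Bochner_Integration.integral_cnj)
    finally show ?thesis using *[of n m] False by simp
  qed (rule *)
qed

lemma orthonormal_szego_bessel:
  assumes mu: "circle_prob_measure \<mu>" and o: "\<And>n. szego_orth \<mu> a n" and a: "\<And>n. cmod (a n) < 1"
    and g: "continuous_on (sphere 0 1) g"
  shows "(\<Sum>n<N. (cmod (LINT w|\<mu>. g w * orthonormal_szego a n w))\<^sup>2) \<le> (LINT w|\<mu>. (cmod (g w))\<^sup>2)"
proof -
  define c where "c n = (LINT w|\<mu>. g w * orthonormal_szego a n w)" for n
  \<comment> \<open>The coefficients \<open>c n\<close> carry no conjugate on
    \<open>orthonormal_szego\<close>, so \<open>S\<close> is the projection of \<open>g\<close> onto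
    the conjugated polynomials, which are orthonormal too.\<close>
  define S where "S w = (\<Sum>n<N. c n * cnj (orthonormal_szego a n w))" for w
  have S: "continuous_on (sphere 0 1) S" unfolding S_def by (intro continuous_intros)
  note int = circle_prob_measure_integrable[OF mu]
  have orth: "(LINT w|\<mu>. (g w - S w) * orthonormal_szego a n w) = 0" if "n < N" for n
  proof -
    have "(LINT w|\<mu>. (g w - S w) * orthonormal_szego a n w)
        = (LINT w|\<mu>. g w * orthonormal_szego a n w - (\<Sum>m<N. c m * (cnj (orthonormal_szego a m w) * orthonormal_szego a n w)))"
      unfolding S_def by (simp add: left_diff_distrib sum_distrib_right mult.assoc)
    also have "\<dots> = c n - (\<Sum>m<N. c m * (LINT w|\<mu>. cnj (orthonormal_szego a m w) * orthonormal_szego a n w))"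
      unfolding c_def
      by (subst Bochner_Integration.integral_diff Bochner_Integration.integral_sum;
          (intro int continuous_intros g)?)+ simp
    also have "\<dots> = 0"
      using that by (simp add: orthonormal_szego_orthonormal[of \<mu> a, OF mu o a] of_bool_def if_distrib cong: if_cong)
    finally show ?thesis .
  qed
  have orthS: "(LINT w|\<mu>. (g w - S w) * cnj (S w)) = 0"
  proof -
    have "(LINT w|\<mu>. (g w - S w) * cnj (S w)) = (LINT w|\<mu>. (\<Sum>n<N. cnj (c n) * ((g w - S w) * orthonormal_szego a n w)))"
      by (intro Bochner_Integration.integral_cong refl)
         (subst (2) S_def, simp add: sum_distrib_left mult_ac)
    also have "\<dots> = (\<Sum>n<N. cnj (c n) * (LINT w|\<mu>. (g w - S w) * orthonormal_szego a n w))"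
      by (subst Bochner_Integration.integral_sum; (intro int continuous_intros g S)?) simp
    also have "\<dots> = 0" using orth by simp
    finally show ?thesis .
  qed
  have Sg: "(LINT w|\<mu>. S w * cnj (g w)) = (\<Sum>n<N. of_real ((cmod (c n))\<^sup>2))"
  proof -
    have "(LINT w|\<mu>. S w * cnj (g w)) = (LINT w|\<mu>. (\<Sum>n<N. c n * cnj (g w * orthonormal_szego a n w)))"
      unfolding S_def by (simp add: sum_distrib_left sum_distrib_right mult_ac)
    also have "\<dots> = (\<Sum>n<N. c n * (LINT w|\<mu>. cnj (g w * orthonormal_szego a n w)))"
      by (subst Bochner_Integration.integral_sum; (intro int continuous_intros g S)?) simp
    also have "\<dots> = (\<Sum>n<N. of_real ((cmod (c n))\<^sup>2))"
      by (simp only: Bochner_Integration.integral_cnj c_def[symmetric] complex_norm_square)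
    finally show ?thesis .
  qed
  have "complex_of_real (LINT w|\<mu>. (cmod (g w - S w))\<^sup>2) = (LINT w|\<mu>. of_real ((cmod (g w - S w))\<^sup>2))"
    by (rule integral_complex_of_real[symmetric])
  also have "\<dots> = (LINT w|\<mu>. of_real ((cmod (g w))\<^sup>2) - S w * cnj (g w) - (g w - S w) * cnj (S w))"
    by (intro Bochner_Integration.integral_cong refl) (simp only: complex_norm_square, simp add: algebra_simps)
  also have "\<dots> = (LINT w|\<mu>. of_real ((cmod (g w))\<^sup>2)) - (LINT w|\<mu>. S w * cnj (g w)) - (LINT w|\<mu>. (g w - S w) * cnj (S w))"
    by (subst Bochner_Integration.integral_diff; (intro int continuous_intros g S)?)+ simp
  also have "\<dots> = of_real ((LINT w|\<mu>. (cmod (g w))\<^sup>2) - (\<Sum>n<N. (cmod (c n))\<^sup>2))"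
    unfolding orthS Sg integral_complex_of_real by simp
  finally have "(LINT w|\<mu>. (cmod (g w - S w))\<^sup>2) = (LINT w|\<mu>. (cmod (g w))\<^sup>2) - (\<Sum>n<N. (cmod (c n))\<^sup>2)"
    by (simp only: of_real_eq_iff)
  moreover have "(LINT w|\<mu>. (cmod (g w - S w))\<^sup>2) \<ge> 0" by simp
  ultimately show ?thesis by (simp add: c_def)
qed

section \<open>The Weyl solution as an integral, and its comparison with the solutions on the
  circle\<close>

text \<open>These are \<open>\<psi>\<^sub>n + F \<phi>\<^sub>n\<close> and \<open>-\<psi>\<^sub>n\<^sup>* + F \<phi>\<^sub>n\<^sup>*\<close> at \<open>\<zeta>\<close>: the two sides obey the same recursion
  with the same initial values.\<close>

definition weyl_u :: "complex measure \<Rightarrow> (nat \<Rightarrow> complex) \<Rightarrow> complex \<Rightarrow> nat \<Rightarrow> complex" where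
  "weyl_u \<mu> a \<zeta> n = (LINT w|\<mu>. 2 * w / (w - \<zeta>) * orthonormal_szego a n w)"

definition weyl_h :: "complex measure \<Rightarrow> (nat \<Rightarrow> complex) \<Rightarrow> complex \<Rightarrow> nat \<Rightarrow> complex" where
  "weyl_h \<mu> a \<zeta> n = (LINT w|\<mu>. 2 * \<zeta> / (w - \<zeta>) * orthonormal_dual a n w)"

lemma weyl_0:
  assumes mu: "circle_prob_measure \<mu>" and \<zeta>: "cmod \<zeta> < 1"
  shows "weyl_u \<mu> a \<zeta> 0 = caratheodory_fun \<mu> \<zeta> + 1" "weyl_h \<mu> a \<zeta> 0 = caratheodory_fun \<mu> \<zeta> - 1"
proof -
  interpret prob_space \<mu> using circle_prob_measureD mu by blast
  have ne: "w - \<zeta> \<noteq> 0" if "cmod w = 1" for w using that \<zeta> by auto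
  have i: "integrable \<mu> (\<lambda>w. (w + \<zeta>) / (w - \<zeta>))"
    using ne by (intro circle_prob_measure_integrable[OF mu] continuous_intros) auto
  have "weyl_u \<mu> a \<zeta> 0 = (LINT w|\<mu>. (w + \<zeta>) / (w - \<zeta>) + 1)"
    unfolding weyl_u_def using ne by (intro circle_integral_cong[OF mu]) (simp add: field_simps)
  also have "\<dots> = caratheodory_fun \<mu> \<zeta> + 1"
    unfolding caratheodory_fun_def using i by (simp add: prob_space)
  finally show "weyl_u \<mu> a \<zeta> 0 = caratheodory_fun \<mu> \<zeta> + 1" .
  have "weyl_h \<mu> a \<zeta> 0 = (LINT w|\<mu>. (w + \<zeta>) / (w - \<zeta>) - 1)"
    unfolding weyl_h_def using ne by (intro circle_integral_cong[OF mu]) (simp add: field_simps)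
  also have "\<dots> = caratheodory_fun \<mu> \<zeta> - 1"
    unfolding caratheodory_fun_def using i by (simp add: prob_space)
  finally show "weyl_h \<mu> a \<zeta> 0 = caratheodory_fun \<mu> \<zeta> - 1" .
qed

text \<open>The recursion of the polynomials is integrated against the kernels. Passing from
  \<open>2w/(w-\<zeta>)\<close> to \<open>2\<zeta>/(w-\<zeta>)\<close> costs the constant 2, whose
  contribution vanishes because \<open>\<phi>\<^sub>n\<^sub>+\<^sub>1\<close> is orthogonal to
  1.\<close>

lemma weyl_Suc:
  assumes mu: "circle_prob_measure \<mu>" and o: "\<And>n. szego_orth \<mu> a n" and a: "\<And>n. cmod (a n) < 1"
    and \<zeta>: "cmod \<zeta> < 1"
  shows "of_real (sqrt (1 - (cmod (a n))\<^sup>2)) * weyl_u \<mu> a \<zeta> (Suc n)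
      = \<zeta> * weyl_u \<mu> a \<zeta> n - cnj (a n) * weyl_h \<mu> a \<zeta> n" (is "?\<rho> * _ = _")
    and "of_real (sqrt (1 - (cmod (a n))\<^sup>2)) * weyl_h \<mu> a \<zeta> (Suc n)
      = weyl_h \<mu> a \<zeta> n - a n * \<zeta> * weyl_u \<mu> a \<zeta> n"
proof -
  note int = circle_prob_measure_integrable[OF mu]
  have ne: "w - \<zeta> \<noteq> 0" if "cmod w = 1" for w using that \<zeta> by auto
  have cu: "continuous_on (sphere 0 1) (\<lambda>w. 2 * w / (w - \<zeta>) * orthonormal_szego a n w)"
    and ch: "continuous_on (sphere 0 1) (\<lambda>w. 2 * \<zeta> / (w - \<zeta>) * orthonormal_dual a n w)" for n
    using ne by (auto intro!: continuous_intros)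
  have zero: "(LINT w|\<mu>. orthonormal_szego a (Suc n) w) = 0"
    using orthonormal_szego_orthonormal[of \<mu> a 0 "Suc n", OF mu o a] by simp
  have "?\<rho> * weyl_u \<mu> a \<zeta> (Suc n) = (LINT w|\<mu>. ?\<rho> * (2 * w / (w - \<zeta>) * orthonormal_szego a (Suc n) w))"
    unfolding weyl_u_def by (rule integral_mult_right_zero[symmetric])
  also have "\<dots> = (LINT w|\<mu>. \<zeta> * (2 * w / (w - \<zeta>) * orthonormal_szego a n w)
      - cnj (a n) * (2 * \<zeta> / (w - \<zeta>) * orthonormal_dual a n w) + 2 * ?\<rho> * orthonormal_szego a (Suc n) w)"
  proof (intro circle_integral_cong[OF mu])
    fix w :: complex assume "cmod w = 1"
    hence "2 * w / (w - \<zeta>) = 2 * \<zeta> / (w - \<zeta>) + 2"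
      using ne by (simp add: field_simps)
    hence "?\<rho> * (2 * w / (w - \<zeta>) * orthonormal_szego a (Suc n) w) - 2 * ?\<rho> * orthonormal_szego a (Suc n) w
        = 2 * \<zeta> / (w - \<zeta>) * (?\<rho> * orthonormal_szego a (Suc n) w)"
      by (simp only:) (simp only: ring_distribs mult_ac, simp)
    also have "\<dots> = \<zeta> * (2 * w / (w - \<zeta>) * orthonormal_szego a n w) - cnj (a n) * (2 * \<zeta> / (w - \<zeta>) * orthonormal_dual a n w)"
      unfolding orthonormal_szego_orthonormal_dual_Suc[of a n w, OF a] by (simp add: algebra_simps)
    finally show "?\<rho> * (2 * w / (w - \<zeta>) * orthonormal_szego a (Suc n) w) = \<zeta> * (2 * w / (w - \<zeta>) * orthonormal_szego a n w)
      - cnj (a n) * (2 * \<zeta> / (w - \<zeta>) * orthonormal_dual a n w) + 2 * ?\<rho> * orthonormal_szego a (Suc n) w"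
      by (simp only: diff_eq_eq)
  qed
  also have "\<dots> = \<zeta> * weyl_u \<mu> a \<zeta> n - cnj (a n) * weyl_h \<mu> a \<zeta> n + 2 * ?\<rho> * (LINT w|\<mu>. orthonormal_szego a (Suc n) w)"
    unfolding weyl_u_def weyl_h_def
    using int[OF cu[of n]] int[OF ch[of n]] int[OF continuous_on_orthonormal_szego[OF continuous_on_id], of a "Suc n"]
    by (simp del: times_divide_eq_left times_divide_eq_right)
  finally show "?\<rho> * weyl_u \<mu> a \<zeta> (Suc n) = \<zeta> * weyl_u \<mu> a \<zeta> n - cnj (a n) * weyl_h \<mu> a \<zeta> n"
    using zero by simp
  have "?\<rho> * weyl_h \<mu> a \<zeta> (Suc n) = (LINT w|\<mu>. ?\<rho> * (2 * \<zeta> / (w - \<zeta>) * orthonormal_dual a (Suc n) w))"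
    unfolding weyl_h_def by (rule integral_mult_right_zero[symmetric])
  also have "\<dots> = (LINT w|\<mu>. 2 * \<zeta> / (w - \<zeta>) * orthonormal_dual a n w - a n * \<zeta> * (2 * w / (w - \<zeta>) * orthonormal_szego a n w))"
  proof (intro circle_integral_cong[OF mu])
    fix w :: complex
    have "?\<rho> * (2 * \<zeta> / (w - \<zeta>) * orthonormal_dual a (Suc n) w) = 2 * \<zeta> / (w - \<zeta>) * (?\<rho> * orthonormal_dual a (Suc n) w)" by simp
    also have "\<dots> = 2 * \<zeta> / (w - \<zeta>) * orthonormal_dual a n w - a n * \<zeta> * (2 * w / (w - \<zeta>) * orthonormal_szego a n w)"
      unfolding orthonormal_szego_orthonormal_dual_Suc[of a n w, OF a] by (simp add: algebra_simps)
    finally show "?\<rho> * (2 * \<zeta> / (w - \<zeta>) * orthonormal_dual a (Suc n) w)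
        = 2 * \<zeta> / (w - \<zeta>) * orthonormal_dual a n w - a n * \<zeta> * (2 * w / (w - \<zeta>) * orthonormal_szego a n w)" .
  qed
  also have "\<dots> = weyl_h \<mu> a \<zeta> n - a n * \<zeta> * weyl_u \<mu> a \<zeta> n"
    unfolding weyl_u_def weyl_h_def
    using int[OF cu[of n]] int[OF ch[of n]] by (simp del: times_divide_eq_left times_divide_eq_right)
  finally show "?\<rho> * weyl_h \<mu> a \<zeta> (Suc n) = weyl_h \<mu> a \<zeta> n - a n * \<zeta> * weyl_u \<mu> a \<zeta> n" .
qed

text \<open>Bessel for \<open>2w/(w-\<zeta>)\<close>: after multiplication by
  \<open>1 - |\<zeta>|\<^sup>2\<close> its squared modulus is four times the Poisson kernel, the
  real part of the Caratheodory kernel.\<close>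

lemma weyl_u_square_sum:
  assumes mu: "circle_prob_measure \<mu>" and o: "\<And>n. szego_orth \<mu> a n" and a: "\<And>n. cmod (a n) < 1"
    and \<zeta>: "cmod \<zeta> < 1"
  shows "(1 - (cmod \<zeta>)\<^sup>2) * (\<Sum>n<N. (cmod (weyl_u \<mu> a \<zeta> n))\<^sup>2) \<le> 4 * Re (caratheodory_fun \<mu> \<zeta>)"
proof -
  have ne: "w - \<zeta> \<noteq> 0" if "cmod w = 1" for w using that \<zeta> by auto
  have r: "(cmod \<zeta>)\<^sup>2 < 1" using \<zeta> by (simp add: abs_square_less_1)
  have "(\<Sum>n<N. (cmod (weyl_u \<mu> a \<zeta> n))\<^sup>2) \<le> (LINT w|\<mu>. (cmod (2 * w / (w - \<zeta>)))\<^sup>2)"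
    unfolding weyl_u_def using ne
    by (intro orthonormal_szego_bessel[of \<mu> a, OF mu o a] continuous_intros) auto
  hence "(1 - (cmod \<zeta>)\<^sup>2) * (\<Sum>n<N. (cmod (weyl_u \<mu> a \<zeta> n))\<^sup>2)
      \<le> (1 - (cmod \<zeta>)\<^sup>2) * (LINT w|\<mu>. (cmod (2 * w / (w - \<zeta>)))\<^sup>2)"
    using r by (intro mult_left_mono) auto
  also have "\<dots> = (LINT w|\<mu>. 4 * Re ((w + \<zeta>) / (w - \<zeta>)))"
    unfolding integral_mult_right_zero[symmetric]
  proof (intro circle_integral_cong[OF mu])
    fix w :: complex assume w: "cmod w = 1"
    have "Re ((w + \<zeta>) / (w - \<zeta>)) = ((cmod w)\<^sup>2 - (cmod \<zeta>)\<^sup>2) / (cmod (w - \<zeta>))\<^sup>2"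
      unfolding Re_divide' cmod_power2 by (simp add: algebra_simps power2_eq_square)
    thus "(1 - (cmod \<zeta>)\<^sup>2) * (cmod (2 * w / (w - \<zeta>)))\<^sup>2 = 4 * Re ((w + \<zeta>) / (w - \<zeta>))"
      using w by (simp add: norm_divide norm_mult power_divide)
  qed
  also have "\<dots> = 4 * Re (caratheodory_fun \<mu> \<zeta>)"
    unfolding caratheodory_fun_def using ne
    by (subst integral_Re[symmetric]) (auto intro!: circle_prob_measure_integrable[OF mu] continuous_intros)
  finally show ?thesis .
qed

text \<open>Only \<open>u\<close> enters the sums, because replacing \<open>z\<close> by \<open>r z\<close> perturbs the first component alone.\<close>

lemma weyl_variation_of_parameters:
  fixes r :: real
  assumes mu: "circle_prob_measure \<mu>" and o: "\<And>n. szego_orth \<mu> a n" and a: "\<And>n. cmod (a n) < 1"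
    and z: "cmod z = 1" and r: "0 \<le> r" "r < 1"
  defines "b \<equiv> \<lambda>n. - a n" and "\<zeta> \<equiv> of_real r * z"
  defines "u \<equiv> weyl_u \<mu> a \<zeta>" and "h \<equiv> weyl_h \<mu> a \<zeta>"
  defines "C \<equiv> \<lambda>n. caratheodory_fun \<mu> \<zeta> - of_real ((1 - r) / 2) * (\<Sum>j<n. cnj (orthonormal_szego b j z) * u j)"
    and "D \<equiv> \<lambda>n. 1 - of_real ((1 - r) / 2) * (\<Sum>j<n. cnj (orthonormal_szego a j z) * u j)"
  shows "u n = C n * orthonormal_szego a n z + D n * orthonormal_szego b n z" "h n = C n * orthonormal_dual a n z - D n * orthonormal_dual b n z"
proof -
  have \<zeta>: "cmod \<zeta> < 1" using r z by (simp add: \<zeta>_def norm_mult)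
  have b: "cmod (b n) < 1" for n using a by (simp add: b_def)
  have "u n = C n * orthonormal_szego a n z + D n * orthonormal_szego b n z \<and> h n = C n * orthonormal_dual a n z - D n * orthonormal_dual b n z"
  proof (induction n)
    case 0
    show ?case using weyl_0[OF mu \<zeta>, of a] by (simp add: u_def h_def C_def D_def)
  next
    case (Suc n)
    define \<rho> where "\<rho> = complex_of_real (sqrt (1 - (cmod (a n))\<^sup>2))"
    define s where "s = complex_of_real ((1 - r) / 2)"
    have rs: "of_real r = 1 - 2 * s" by (simp add: s_def field_simps)
    define \<phi> \<phi>' \<psi> \<psi>' where "\<phi> = orthonormal_szego a n z" and "\<phi>' = orthonormal_dual a n z" and "\<psi> = orthonormal_szego b n z" and "\<psi>' = orthonormal_dual b n z"
    have "(cmod (a n))\<^sup>2 < 1" using a[of n] by (simp add: abs_square_less_1)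
    hence \<rho>0: "\<rho> \<noteq> 0" by (simp add: \<rho>_def)
    have rec: "\<rho> * orthonormal_szego a (Suc n) z = z * \<phi> - cnj (a n) * \<phi>'"
      "\<rho> * orthonormal_dual a (Suc n) z = \<phi>' - a n * z * \<phi>"
      "\<rho> * orthonormal_szego b (Suc n) z = z * \<psi> + cnj (a n) * \<psi>'"
      "\<rho> * orthonormal_dual b (Suc n) z = \<psi>' + a n * z * \<psi>"
      using orthonormal_szego_orthonormal_dual_Suc[of a n z, OF a] orthonormal_szego_orthonormal_dual_Suc[of b n z, OF b]
      by (simp_all add: \<rho>_def b_def \<phi>_def \<phi>'_def \<psi>_def \<psi>'_def)
    have ru: "\<rho> * u (Suc n) = \<zeta> * u n - cnj (a n) * h n" "\<rho> * h (Suc n) = h n - a n * \<zeta> * u n"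
      using weyl_Suc[of \<mu> a \<zeta> n, OF mu o a \<zeta>] by (simp_all add: u_def h_def \<rho>_def)
    have CS: "C (Suc n) = C n - s * (cnj \<psi> * u n)" "D (Suc n) = D n - s * (cnj \<phi> * u n)"
      unfolding C_def D_def s_def[symmetric] \<psi>_def \<phi>_def by (simp_all add: algebra_simps)
    have IH: "u n = C n * \<phi> + D n * \<psi>" "h n = C n * \<phi>' - D n * \<psi>'"
      using Suc by (simp_all add: \<phi>_def \<phi>'_def \<psi>_def \<psi>'_def)
    \<comment> \<open>By \<open>W\<close> and \<open>W'\<close>, updating \<open>C\<close> and
      \<open>D\<close> adds \<open>-2s * u n\<close> to the first component at \<open>z\<close> and
      nothing to the second. The first component becomes \<open>r * u n\<close>, exactly what the
      transfer matrix at \<open>r z\<close> requires.\<close>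
    have W: "cnj \<phi> * \<psi> + \<phi> * cnj \<psi> = 2"
      using orthonormal_szego_second_kind_circle[of a z n, OF a z] by (simp add: \<phi>_def \<psi>_def b_def)
    have W': "cnj \<psi> * \<phi>' - cnj \<phi> * \<psi>' = 0"
      by (simp add: \<phi>'_def \<psi>'_def \<phi>_def \<psi>_def orthonormal_dual_circle[OF z])
    have "\<rho> * (C (Suc n) * orthonormal_szego a (Suc n) z + D (Suc n) * orthonormal_szego b (Suc n) z)
        = C (Suc n) * (\<rho> * orthonormal_szego a (Suc n) z) + D (Suc n) * (\<rho> * orthonormal_szego b (Suc n) z)" by (simp add: algebra_simps)
    also have "\<dots> = z * (C n * \<phi> + D n * \<psi>) - cnj (a n) * (C n * \<phi>' - D n * \<psi>')
        - s * u n * (z * (cnj \<phi> * \<psi> + \<phi> * cnj \<psi>) - cnj (a n) * (cnj \<psi> * \<phi>' - cnj \<phi> * \<psi>'))"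
      unfolding rec CS by (simp add: algebra_simps)
    also have "\<dots> = \<rho> * u (Suc n)"
      unfolding W W' IH[symmetric] ru \<zeta>_def rs by (simp add: algebra_simps)
    finally have 1: "u (Suc n) = C (Suc n) * orthonormal_szego a (Suc n) z + D (Suc n) * orthonormal_szego b (Suc n) z"
      using \<rho>0 by simp
    have "\<rho> * (C (Suc n) * orthonormal_dual a (Suc n) z - D (Suc n) * orthonormal_dual b (Suc n) z)
        = C (Suc n) * (\<rho> * orthonormal_dual a (Suc n) z) - D (Suc n) * (\<rho> * orthonormal_dual b (Suc n) z)" by (simp add: algebra_simps)
    also have "\<dots> = (C n * \<phi>' - D n * \<psi>') - a n * z * (C n * \<phi> + D n * \<psi>)
        - s * u n * ((cnj \<psi> * \<phi>' - cnj \<phi> * \<psi>') - a n * z * (cnj \<phi> * \<psi> + \<phi> * cnj \<psi>))"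
      unfolding rec CS by (simp add: algebra_simps)
    also have "\<dots> = \<rho> * h (Suc n)"
      unfolding W W' IH[symmetric] ru \<zeta>_def rs by (simp add: algebra_simps)
    finally have "h (Suc n) = C (Suc n) * orthonormal_dual a (Suc n) z - D (Suc n) * orthonormal_dual b (Suc n) z"
      using \<rho>0 by simp
    with 1 show ?case by blast
  qed
  thus "u n = C n * orthonormal_szego a n z + D n * orthonormal_szego b n z" "h n = C n * orthonormal_dual a n z - D n * orthonormal_dual b n z" by blast+
qed

section \<open>The Jitomirskaya-Last inequality\<close>

text \<open>The formula stays valid at the right endpoint, where the integral part jumps. This gives
  continuity on closed unit intervals for the intermediate value theorem.\<close>

lemma trunc_norm_on_interval:
  assumes "real m \<le> x" "x \<le> real m + 1"
  shows "trunc_norm a x = sqrt ((\<Sum>j\<le>m. (cmod (a j))\<^sup>2) + (x - real m) * (cmod (a (Suc m)))\<^sup>2)"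
proof (cases "x = real m + 1")
  case True
  hence fl: "\<lfloor>x\<rfloor> = int (Suc m)" by (simp add: floor_eq_iff)
  show ?thesis unfolding trunc_norm_def frac_def fl nat_int using True by (simp add: atLeast0AtMost)
next
  case False
  hence fl: "\<lfloor>x\<rfloor> = int m" using assms by (simp add: floor_eq_iff)
  show ?thesis unfolding trunc_norm_def frac_def fl by (simp add: atLeast0AtMost)
qed

lemma trunc_norm_of_nat: "trunc_norm a (real m) = sqrt (\<Sum>j\<le>m. (cmod (a j))\<^sup>2)"
  by (subst trunc_norm_on_interval[of m]) auto

lemma trunc_norm_nonneg: "trunc_norm a x \<ge> 0"
  unfolding trunc_norm_def by (intro real_sqrt_ge_zero add_nonneg_nonneg sum_nonneg) (auto simp: frac_ge_0)

lemma trunc_norm_pos: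
  assumes "a 0 \<noteq> 0"
  shows "trunc_norm a x > 0"
proof -
  have "(cmod (a 0))\<^sup>2 \<le> (\<Sum>j=0..nat \<lfloor>x\<rfloor>. (cmod (a j))\<^sup>2)"
    by (rule member_le_sum[of 0 "{0..nat \<lfloor>x\<rfloor>}" "\<lambda>j. (cmod (a j))\<^sup>2"]) auto
  moreover have "(cmod (a 0))\<^sup>2 > 0" using assms by simp
  moreover have "frac x * (cmod (a (nat \<lfloor>x\<rfloor> + 1)))\<^sup>2 \<ge> 0" by (simp add: frac_ge_0)
  ultimately show ?thesis unfolding trunc_norm_def by (intro real_sqrt_gt_zero) linarith
qed

lemma trunc_norm_strict_mono:
  assumes a: "\<And>j. a j \<noteq> 0" and xy: "0 \<le> x" "x < y"
  shows "trunc_norm a x < trunc_norm a y"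
proof -
  define m where "m = nat \<lfloor>x\<rfloor>"
  have m: "real m \<le> x" "x < real m + 1" using xy(1) unfolding m_def by linarith+
  define S where "S k = (\<Sum>j\<le>k. (cmod (a j))\<^sup>2)" for k
  have pos: "(cmod (a j))\<^sup>2 > 0" for j using a by simp
  have tx: "trunc_norm a x = sqrt (S m + (x - real m) * (cmod (a (Suc m)))\<^sup>2)"
    unfolding S_def using m by (intro trunc_norm_on_interval) auto
  show ?thesis
  proof (cases "y \<le> real m + 1")
    case True
    have "trunc_norm a y = sqrt (S m + (y - real m) * (cmod (a (Suc m)))\<^sup>2)"
      unfolding S_def using m xy True by (intro trunc_norm_on_interval) auto
    thus ?thesis unfolding tx using xy pos[of "Suc m"] by simp
  next
    case False
    define k where "k = nat \<lfloor>y\<rfloor>"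
    have k: "real k \<le> y" "y < real k + 1" "Suc m \<le> k" using xy False unfolding k_def by linarith+
    have ty: "trunc_norm a y = sqrt (S k + (y - real k) * (cmod (a (Suc k)))\<^sup>2)"
      unfolding S_def using k by (intro trunc_norm_on_interval) auto
    have "(x - real m) * (cmod (a (Suc m)))\<^sup>2 < 1 * (cmod (a (Suc m)))\<^sup>2"
      using m pos by (intro mult_strict_right_mono) auto
    hence "S m + (x - real m) * (cmod (a (Suc m)))\<^sup>2 < S (Suc m)" by (simp add: S_def)
    also have "S (Suc m) \<le> S k" unfolding S_def using k by (intro sum_mono2) auto
    also have "\<dots> \<le> S k + (y - real k) * (cmod (a (Suc k)))\<^sup>2" using k by simp
    finally show ?thesis unfolding tx ty by simp
  qed
qed

lemma trunc_norm_mult_unique_solution: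
  assumes ab: "\<And>j. cmod (a j) * cmod (b j) \<ge> 1" and T: "cmod (a 0) * cmod (b 0) \<le> T"
  shows "\<exists>!x. 0 \<le> x \<and> trunc_norm a x * trunc_norm b x = T"
proof (rule ex_ex1I)
  let ?P = "\<lambda>x. trunc_norm a x * trunc_norm b x"
  \<comment> \<open>Cauchy-Schwarz turns the pointwise bound on
    \<open>|a\<^sub>j| |b\<^sub>j|\<close> into linear growth of the product, so it exceeds any
    \<open>T\<close>.\<close>
  have ge: "?P (real m) \<ge> real m + 1" for m
  proof -
    have "real m + 1 = (\<Sum>j\<le>m. 1)" by simp
    also have "\<dots> \<le> (\<Sum>j\<le>m. \<bar>cmod (a j)\<bar> * \<bar>cmod (b j)\<bar>)" using ab by (intro sum_mono) simp
    also have "\<dots> \<le> L2_set (\<lambda>j. cmod (a j)) {..m} * L2_set (\<lambda>j. cmod (b j)) {..m}"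
      by (rule L2_set_mult_ineq)
    also have "\<dots> = ?P (real m)" by (simp add: L2_set_def trunc_norm_of_nat)
    finally show ?thesis .
  qed
  have gt: "\<exists>n. ?P (real n) > T"
  proof -
    obtain n where "T < real n" using reals_Archimedean2 by blast
    thus ?thesis using ge[of n] by (intro exI[of _ n]) linarith
  qed
  \<comment> \<open>The hypothesis on \<open>T\<close> excludes \<open>k = 0\<close>; the solution
    then lies between the integers \<open>k - 1\<close> and \<open>k\<close>.\<close>
  define k where "k = (LEAST n. ?P (real n) > T)"
  have k: "?P (real k) > T" unfolding k_def by (rule LeastI_ex[OF gt])
  moreover have "?P (real 0) \<le> T" using T trunc_norm_of_nat[of _ 0] by simp
  ultimately obtain m where km: "k = Suc m" by (cases k) auto
  have "\<not> ?P (real m) > T"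
    by (rule not_less_Least) (simp only: k_def[symmetric] km lessI)
  hence m: "?P (real m) \<le> T" "T \<le> ?P (real m + 1)"
    using k by (simp_all add: km add.commute)
  have "continuous_on {real m..real m + 1} ?P"
  proof (subst continuous_on_cong[OF refl])
    fix x assume "x \<in> {real m..real m + 1}"
    thus "?P x = sqrt ((\<Sum>j\<le>m. (cmod (a j))\<^sup>2) + (x - real m) * (cmod (a (Suc m)))\<^sup>2)
        * sqrt ((\<Sum>j\<le>m. (cmod (b j))\<^sup>2) + (x - real m) * (cmod (b (Suc m)))\<^sup>2)"
      by (simp add: trunc_norm_on_interval[of m])
  qed (intro continuous_intros)
  then obtain x where "real m \<le> x" "?P x = T"
    using IVT'[of ?P "real m" T "real m + 1"] m by auto
  thus "\<exists>x. 0 \<le> x \<and> ?P x = T" by (intro exI[of _ x]) auto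
next
  let ?P = "\<lambda>x. trunc_norm a x * trunc_norm b x"
  have nz: "a j \<noteq> 0" "b j \<noteq> 0" for j using ab[of j] by auto
  have mono: "?P x < ?P y" if "0 \<le> x" "x < y" for x y
    using trunc_norm_strict_mono[of a x y, OF nz(1) that] trunc_norm_strict_mono[of b x y, OF nz(2) that]
    by (intro mult_strict_mono) (auto simp: trunc_norm_nonneg trunc_norm_pos nz)
  fix x y assume "0 \<le> x \<and> ?P x = T" "0 \<le> y \<and> ?P y = T"
  thus "x = y" using mono[of x y] mono[of y x] by linarith
qed

text \<open>Interpolating the squared norm linearly amounts to a weighted l2 norm whose last weight
  is \<open>sqrt (frac x)\<close>; thus Minkowski's inequality is available.\<close>

lemma trunc_norm_L2:
  "trunc_norm a x = L2_set (\<lambda>j. (if j \<le> nat \<lfloor>x\<rfloor> then 1 else sqrt (frac x)) * cmod (a j)) {..Suc (nat \<lfloor>x\<rfloor>)}"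
  unfolding trunc_norm_def L2_set_def
  by (simp add: atLeast0AtMost power_mult_distrib frac_ge_0)

text \<open>Since the sum stops at \<open>n - 1\<close>, the range of \<open>n\<close> includes the
  last, fractionally weighted index of the norm, while the sum itself uses only fully weighted
  terms.\<close>

lemma sum_le_trunc_norm_mult:
  assumes "n \<le> Suc (nat \<lfloor>x\<rfloor>)"
  shows "cmod (\<Sum>j<n. cnj (a j) * b j) \<le> trunc_norm a x * trunc_norm b x"
proof -
  have le: "L2_set (\<lambda>j. cmod (c j)) {..<n} \<le> trunc_norm c x" for c
  proof -
    have "(\<Sum>j<n. (cmod (c j))\<^sup>2) \<le> (\<Sum>j=0..nat \<lfloor>x\<rfloor>. (cmod (c j))\<^sup>2)"
      using assms by (intro sum_mono2) auto
    also have "\<dots> \<le> (\<Sum>j=0..nat \<lfloor>x\<rfloor>. (cmod (c j))\<^sup>2) + frac x * (cmod (c (nat \<lfloor>x\<rfloor> + 1)))\<^sup>2"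
      by (simp add: frac_ge_0)
    finally show ?thesis unfolding trunc_norm_def L2_set_def by simp
  qed
  have "cmod (\<Sum>j<n. cnj (a j) * b j) \<le> (\<Sum>j<n. \<bar>cmod (a j)\<bar> * \<bar>cmod (b j)\<bar>)"
    by (rule sum_norm_le) (simp add: norm_mult)
  also have "\<dots> \<le> L2_set (\<lambda>j. cmod (a j)) {..<n} * L2_set (\<lambda>j. cmod (b j)) {..<n}"
    by (rule L2_set_mult_ineq)
  also have "\<dots> \<le> trunc_norm a x * trunc_norm b x"
    by (intro mult_mono le L2_set_nonneg trunc_norm_nonneg)
  finally show ?thesis .
qed

lemma trunc_norm_bound:
  assumes "\<And>j. j \<le> Suc (nat \<lfloor>x\<rfloor>) \<Longrightarrow> cmod (d j) \<le> cmod (a j) + \<beta> * cmod (b j) + \<gamma> * cmod (c j)"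
    and "0 \<le> \<beta>" "0 \<le> \<gamma>"
  shows "trunc_norm d x \<le> trunc_norm a x + \<beta> * trunc_norm b x + \<gamma> * trunc_norm c x"
proof -
  define wt where "wt j = (if j \<le> nat \<lfloor>x\<rfloor> then 1 else sqrt (frac x))" for j
  have wt: "wt j \<ge> 0" for j by (simp add: wt_def frac_ge_0)
  let ?A = "{..Suc (nat \<lfloor>x\<rfloor>)}"
  have tn: "trunc_norm a x = L2_set (\<lambda>j. wt j * cmod (a j)) ?A" for a
    unfolding trunc_norm_L2 wt_def ..
  have "trunc_norm d x \<le> L2_set (\<lambda>j. (wt j * cmod (a j) + \<beta> * (wt j * cmod (b j))) + \<gamma> * (wt j * cmod (c j))) ?A"
    unfolding tn
  proof (intro L2_set_mono mult_nonneg_nonneg wt norm_ge_zero)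
    fix j assume "j \<in> ?A"
    hence "wt j * cmod (d j) \<le> wt j * (cmod (a j) + \<beta> * cmod (b j) + \<gamma> * cmod (c j))"
      using assms(1) wt by (intro mult_left_mono) auto
    thus "wt j * cmod (d j) \<le> (wt j * cmod (a j) + \<beta> * (wt j * cmod (b j))) + \<gamma> * (wt j * cmod (c j))"
      by (simp add: algebra_simps)
  qed
  also have "\<dots> \<le> L2_set (\<lambda>j. wt j * cmod (a j) + \<beta> * (wt j * cmod (b j))) ?A + L2_set (\<lambda>j. \<gamma> * (wt j * cmod (c j))) ?A"
    by (rule L2_set_triangle_ineq)
  also have "\<dots> \<le> (L2_set (\<lambda>j. wt j * cmod (a j)) ?A + L2_set (\<lambda>j. \<beta> * (wt j * cmod (b j))) ?A)
      + L2_set (\<lambda>j. \<gamma> * (wt j * cmod (c j))) ?A"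
    by (intro add_right_mono L2_set_triangle_ineq)
  also have "\<dots> = trunc_norm a x + \<beta> * trunc_norm b x + \<gamma> * trunc_norm c x"
    unfolding tn using assms(2,3) by (simp only: L2_set_right_distrib)
  finally show ?thesis .
qed

section \<open>The two-sided bound with an explicit constant\<close>

lemma jitomirskaya_last:
  fixes r x :: real
  assumes mu: "circle_prob_measure \<mu>" and o: "\<And>n. szego_orth \<mu> a n" and a: "\<And>n. cmod (a n) < 1"
    and z: "cmod z = 1" and r: "0 \<le> r" "r < 1"
  defines "N\<phi> \<equiv> trunc_norm (\<lambda>n. orthonormal_szego a n z) x" and "N\<psi> \<equiv> trunc_norm (\<lambda>n. orthonormal_szego (\<lambda>k. - a k) n z) x"
    and "F \<equiv> caratheodory_fun \<mu> (of_real r * z)"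
  assumes x: "(1 - r) * N\<phi> * N\<psi> = sqrt 2"
  shows "inverse 20 * (N\<psi> / N\<phi>) \<le> cmod F" "cmod F \<le> 20 * (N\<psi> / N\<phi>)"
proof -
  define b where "b n = - a n" for n
  define \<phi> \<psi> where "\<phi> n = orthonormal_szego a n z" and "\<psi> n = orthonormal_szego b n z" for n
  define u where "u = weyl_u \<mu> a (of_real r * z)"
  define Nu where "Nu = trunc_norm u x"
  define s where "s = (1 - r) / 2"
  have s: "s \<ge> 0" using r by (simp add: s_def)
  have N: "N\<phi> = trunc_norm \<phi> x" "N\<psi> = trunc_norm \<psi> x"
    unfolding N\<phi>_def N\<psi>_def \<phi>_def \<psi>_def b_def by simp_all
  have Npos: "N\<phi> > 0" "N\<psi> > 0" unfolding N by (auto intro!: trunc_norm_pos simp: \<phi>_def \<psi>_def)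
  have Nu: "Nu \<ge> 0" unfolding Nu_def by (rule trunc_norm_nonneg)
  have \<zeta>: "cmod (of_real r * z) < 1" using r z by (simp add: norm_mult)
  define e where "e n = F * \<phi> n + \<psi> n" for n
  \<comment> \<open>The variation of parameters solved for
    \<open>F \<phi>\<^sub>n + \<psi>\<^sub>n\<close>, with the perturbation on the right.\<close>
  have e: "e n = u n + of_real s * (\<Sum>j<n. cnj (\<psi> j) * u j) * \<phi> n
      + of_real s * (\<Sum>j<n. cnj (\<phi> j) * u j) * \<psi> n" for n
    using weyl_variation_of_parameters(1)[of \<mu> a z r n, OF mu o a z r]
    unfolding e_def F_def u_def \<phi>_def \<psi>_def b_def s_def by (simp add: algebra_simps)
  have "trunc_norm e x \<le> Nu + s * (N\<psi> * Nu) * N\<phi> + s * (N\<phi> * Nu) * N\<psi>"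
    unfolding Nu_def N
  proof (intro trunc_norm_bound mult_nonneg_nonneg s trunc_norm_nonneg)
    fix n assume n: "n \<le> Suc (nat \<lfloor>x\<rfloor>)"
    have "cmod (e n) \<le> cmod (u n) + cmod (of_real s * (\<Sum>j<n. cnj (\<psi> j) * u j) * \<phi> n)
      + cmod (of_real s * (\<Sum>j<n. cnj (\<phi> j) * u j) * \<psi> n)"
      unfolding e by (intro order_trans[OF norm_triangle_ineq] add_right_mono norm_triangle_ineq)
    also have "\<dots> \<le> cmod (u n) + s * (trunc_norm \<psi> x * trunc_norm u x) * cmod (\<phi> n)
      + s * (trunc_norm \<phi> x * trunc_norm u x) * cmod (\<psi> n)"
      unfolding norm_mult using s n
      by (intro add_mono order_refl mult_right_mono mult_mono sum_le_trunc_norm_mult) auto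
    finally show "cmod (e n) \<le> cmod (u n) + s * (trunc_norm \<psi> x * trunc_norm u x) * cmod (\<phi> n)
      + s * (trunc_norm \<phi> x * trunc_norm u x) * cmod (\<psi> n)" .
  qed
  \<comment> \<open>The two perturbation terms are equal, and their sum has the factor that defines
    \<open>x\<close>.\<close>
  also have "\<dots> = (1 + (1 - r) * N\<phi> * N\<psi>) * Nu" by (simp add: s_def field_simps)
  finally have eN: "trunc_norm e x \<le> (1 + sqrt 2) * Nu" unfolding x .
  define X where "X = cmod F * N\<phi>"
  have X0: "X \<ge> 0" using Npos by (simp add: X_def)
  have "N\<psi> \<le> trunc_norm e x + cmod F * N\<phi> + 0 * N\<phi>"
    unfolding N
  proof (rule trunc_norm_bound)
    fix j
    have "cmod (\<psi> j) = cmod (e j - F * \<phi> j)" by (simp add: e_def)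
    also have "\<dots> \<le> cmod (e j) + cmod (F * \<phi> j)" by (rule norm_triangle_ineq4)
    finally show "cmod (\<psi> j) \<le> cmod (e j) + cmod F * cmod (\<phi> j) + 0 * cmod (\<phi> j)" by (simp add: norm_mult)
  qed auto
  moreover have "X \<le> trunc_norm e x + N\<psi>"
  proof -
    have "trunc_norm (\<lambda>j. F * \<phi> j) x \<le> trunc_norm e x + 1 * N\<psi> + 0 * N\<psi>"
      unfolding N
    proof (rule trunc_norm_bound)
      fix j
      have "cmod (F * \<phi> j) = cmod (e j - \<psi> j)" by (simp add: e_def)
      also have "\<dots> \<le> cmod (e j) + cmod (\<psi> j)" by (rule norm_triangle_ineq4)
      finally show "cmod (F * \<phi> j) \<le> cmod (e j) + 1 * cmod (\<psi> j) + 0 * cmod (\<psi> j)" by simp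
    qed auto
    moreover have "trunc_norm (\<lambda>j. F * \<phi> j) x = X"
      unfolding X_def N trunc_norm_L2 by (simp add: L2_set_right_distrib norm_mult mult.left_commute)
    ultimately show ?thesis by simp
  qed
  ultimately have "\<bar>X - N\<psi>\<bar> \<le> (1 + sqrt 2) * Nu" using eN by (simp add: X_def)
  hence "\<bar>X - N\<psi>\<bar>\<^sup>2 \<le> ((1 + sqrt 2) * Nu)\<^sup>2" by (rule power_mono) simp
  hence "(X - N\<psi>)\<^sup>2 \<le> (1 + sqrt 2)\<^sup>2 * Nu\<^sup>2" by (simp add: power_mult_distrib)
  also have "(1 + sqrt 2)\<^sup>2 = 3 + 2 * sqrt 2" by (simp add: power2_sum)
  finally have 1: "(X - N\<psi>)\<^sup>2 \<le> (3 + 2 * sqrt 2) * Nu\<^sup>2" .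
  \<comment> \<open>Bounding the fractional weight by 1 reduces to a full partial sum, to which
    Bessel applies.\<close>
  have Nu2: "Nu\<^sup>2 \<le> (\<Sum>n<Suc (Suc (nat \<lfloor>x\<rfloor>)). (cmod (u n))\<^sup>2)"
  proof -
    have "frac x * (cmod (u (Suc (nat \<lfloor>x\<rfloor>))))\<^sup>2 \<le> 1 * (cmod (u (Suc (nat \<lfloor>x\<rfloor>))))\<^sup>2"
      by (intro mult_right_mono) (auto simp: less_imp_le[OF frac_lt_1])
    moreover have "Nu\<^sup>2 = (\<Sum>j=0..nat \<lfloor>x\<rfloor>. (cmod (u j))\<^sup>2) + frac x * (cmod (u (nat \<lfloor>x\<rfloor> + 1)))\<^sup>2"
      unfolding Nu_def trunc_norm_def
      by (intro real_sqrt_pow2 add_nonneg_nonneg sum_nonneg) (auto simp: frac_ge_0)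
    ultimately show ?thesis by (simp add: atLeast0AtMost lessThan_Suc_atMost)
  qed
  have "(1 - r) * Nu\<^sup>2 \<le> (1 - r\<^sup>2) * Nu\<^sup>2"
    using r by (intro mult_right_mono) (auto simp: power2_eq_square mult_left_le_one_le)
  also have "\<dots> \<le> (1 - r\<^sup>2) * (\<Sum>n<Suc (Suc (nat \<lfloor>x\<rfloor>)). (cmod (u n))\<^sup>2)"
    using r by (intro mult_left_mono Nu2) (auto simp: power_le_one)
  also have "\<dots> \<le> 4 * Re F"
    using weyl_u_square_sum[of \<mu> a "of_real r * z", OF mu o a \<zeta>] z r unfolding F_def u_def
    by (simp add: norm_mult del: sum.lessThan_Suc)
  also have "\<dots> \<le> 4 * cmod F" using complex_Re_le_cmod[of F] by simp
  finally have "(1 - r) * Nu\<^sup>2 * (N\<phi> * N\<psi>) \<le> 4 * cmod F * (N\<phi> * N\<psi>)"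
    using Npos by (intro mult_right_mono) auto
  \<comment> \<open>The defining equation of \<open>x\<close> is used a second time: multiplying by
    both norms removes \<open>1 - r\<close> in favour of \<open>sqrt 2\<close>.\<close>
  hence "((1 - r) * N\<phi> * N\<psi>) * Nu\<^sup>2 \<le> 4 * (X * N\<psi>)" by (simp add: X_def mult_ac)
  hence 2: "sqrt 2 * Nu\<^sup>2 \<le> 4 * (X * N\<psi>)" unfolding x .
  \<comment> \<open>From \<open>sqrt 2 \<ge> 1.4\<close> one gets
    \<open>3 + 2 * sqrt 2 \<le> 4.5 * sqrt 2\<close>, and \<open>4.5 * 4 = 18\<close>. Expanding the
    square then adds 2, which is the source of 20.\<close>
  have "1.4 \<le> sqrt 2" by (rule real_le_rsqrt) (simp add: power2_eq_square)
  hence "(3 + 2 * sqrt 2) * Nu\<^sup>2 \<le> (4.5 * sqrt 2) * Nu\<^sup>2" by (intro mult_right_mono) auto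
  hence "(X - N\<psi>)\<^sup>2 \<le> 18 * (X * N\<psi>)" using 1 2 by linarith
  moreover have "(X - N\<psi>)\<^sup>2 = X * X + N\<psi> * N\<psi> - 2 * (X * N\<psi>)"
    unfolding power2_eq_square by (simp only: left_diff_distrib right_diff_distrib mult.commute)
  ultimately have 3: "X * X + N\<psi> * N\<psi> \<le> 20 * (X * N\<psi>)" by linarith
  have "X * X \<ge> 0" "N\<psi> * N\<psi> \<ge> 0" by simp_all
  \<comment> \<open>Dropping either square leaves a linear comparison of \<open>X\<close> with
    \<open>N\<psi>\<close>, one for each direction.\<close>
  hence "N\<psi> * N\<psi> \<le> (20 * X) * N\<psi>" "X * X \<le> (20 * N\<psi>) * X" using 3
    by (simp_all only: mult.assoc mult.commute[of N\<psi> X])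
  hence lower: "N\<psi> \<le> 20 * X" and upper': "X * X \<le> (20 * N\<psi>) * X" using Npos by simp_all
  have "X > 0" using lower Npos by linarith
  with upper' have upper: "X \<le> 20 * N\<psi>" by (simp only: mult_le_cancel_right_pos)
  show "inverse 20 * (N\<psi> / N\<phi>) \<le> cmod F" using lower Npos by (simp add: X_def field_simps)
  show "cmod F \<le> 20 * (N\<psi> / N\<phi>)" using upper Npos by (simp add: X_def field_simps)
qed

section \<open>Return to the polynomials of the measure\<close>

lemma poly_orthonormal_op:
  "nontrivial_circle_measure \<mu> \<Longrightarrow> poly (orthonormal_op \<mu> n) z = orthonormal_szego (verblunsky \<mu>) n z"
  by (simp add: orthonormal_op_verblunsky orthonormal_szego_def)

text \<open>Verblunsky's existence theorem is what gives the choice in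
  \<open>second_kind_measure\<close> its defining property.\<close>

lemma poly_second_kind_op:
  assumes nt: "nontrivial_circle_measure \<mu>"
  shows "poly (second_kind_op \<mu> n) z = orthonormal_szego (\<lambda>k. - verblunsky \<mu> k) n z"
proof -
  let ?\<nu> = "second_kind_measure \<mu>"
  have "\<exists>\<nu>. nontrivial_circle_measure \<nu> \<and> (\<forall>n. verblunsky \<nu> n = - verblunsky \<mu> n)"
    using verblunsky_exists[of "\<lambda>n. - verblunsky \<mu> n"] cmod_verblunsky_less_1[OF nt] by simp
  from someI_ex[OF this] have "nontrivial_circle_measure ?\<nu>" "verblunsky ?\<nu> = (\<lambda>k. - verblunsky \<mu> k)"
    unfolding second_kind_measure_def by auto
  thus ?thesis unfolding second_kind_op_def by (simp add: poly_orthonormal_op)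
qed

theorem theorem4p1:
  "\<exists>A::real. 1 < A \<and>
     (\<forall>(\<mu> :: complex measure) (z :: complex) (r :: real).
        nontrivial_circle_measure \<mu> \<longrightarrow> z \<in> sphere 0 1 \<longrightarrow> 0 \<le> r \<longrightarrow> r < 1 \<longrightarrow>
        (let N\<phi> = trunc_norm (\<lambda>n. poly (orthonormal_op \<mu> n) z);
             N\<psi> = trunc_norm (\<lambda>n. poly (second_kind_op \<mu> n) z)
         in (\<exists>!x. 0 \<le> x \<and> (1 - r) * N\<phi> x * N\<psi> x = sqrt 2) \<and>
            (\<forall>x. 0 \<le> x \<and> (1 - r) * N\<phi> x * N\<psi> x = sqrt 2 \<longrightarrow>
                 inverse A * (N\<psi> x / N\<phi> x) \<le> cmod (caratheodory_fun \<mu> (complex_of_real r * z)) \<and>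
                 cmod (caratheodory_fun \<mu> (complex_of_real r * z)) \<le> A * (N\<psi> x / N\<phi> x))))"
proof (intro exI[of _ 20] conjI allI impI)
  fix \<mu> :: "complex measure" and z :: complex and r :: real
  assume nt: "nontrivial_circle_measure \<mu>" and "z \<in> sphere 0 1" and r: "0 \<le> r" "r < 1"
  hence z: "cmod z = 1" by simp
  define a where "a = verblunsky \<mu>"
  have a: "cmod (a n) < 1" for n unfolding a_def by (rule cmod_verblunsky_less_1[OF nt])
  have o: "szego_orth \<mu> a n" for n unfolding a_def by (rule szego_orth_verblunsky[OF nt])
  define \<phi> \<psi> where "\<phi> n = orthonormal_szego a n z" and "\<psi> n = orthonormal_szego (\<lambda>k. - a k) n z" for n
  have "cmod (\<phi> n) * cmod (\<psi> n) \<ge> 1" for n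
  proof -
    have "2 = cmod (cnj (\<phi> n) * \<psi> n + \<phi> n * cnj (\<psi> n))"
      unfolding \<phi>_def \<psi>_def using orthonormal_szego_second_kind_circle[of a z n, OF a z] by simp
    also have "\<dots> \<le> cmod (cnj (\<phi> n) * \<psi> n) + cmod (\<phi> n * cnj (\<psi> n))" by (rule norm_triangle_ineq)
    finally show ?thesis by (simp add: norm_mult)
  qed
  \<comment> \<open>At \<open>x = 0\<close> both norms equal 1, and
    \<open>1 - r \<le> 1 \<le> sqrt 2\<close>; so the product starts at or below its target.\<close>
  moreover have "cmod (\<phi> 0) * cmod (\<psi> 0) \<le> sqrt 2 / (1 - r)"
  proof -
    have "1 - r \<le> sqrt 2" using r by (intro order_trans[OF _ real_sqrt_ge_one]) auto
    thus ?thesis using r by (simp add: \<phi>_def \<psi>_def)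
  qed
  ultimately have "\<exists>!x. 0 \<le> x \<and> trunc_norm \<phi> x * trunc_norm \<psi> x = sqrt 2 / (1 - r)"
    by (rule trunc_norm_mult_unique_solution)
  moreover have "(1 - r) * trunc_norm \<phi> x * trunc_norm \<psi> x = sqrt 2
      \<longleftrightarrow> trunc_norm \<phi> x * trunc_norm \<psi> x = sqrt 2 / (1 - r)" for x
    using r by (auto simp: field_simps)
  ultimately have ex: "\<exists>!x. 0 \<le> x \<and> (1 - r) * trunc_norm \<phi> x * trunc_norm \<psi> x = sqrt 2" by simp
  have op: "(\<lambda>n. poly (orthonormal_op \<mu> n) z) = \<phi>" "(\<lambda>n. poly (second_kind_op \<mu> n) z) = \<psi>"
    unfolding \<phi>_def \<psi>_def a_def
    by (simp_all add: fun_eq_iff poly_orthonormal_op[OF nt] poly_second_kind_op[OF nt])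
  show "let N\<phi> = trunc_norm (\<lambda>n. poly (orthonormal_op \<mu> n) z);
             N\<psi> = trunc_norm (\<lambda>n. poly (second_kind_op \<mu> n) z)
         in (\<exists>!x. 0 \<le> x \<and> (1 - r) * N\<phi> x * N\<psi> x = sqrt 2) \<and>
            (\<forall>x. 0 \<le> x \<and> (1 - r) * N\<phi> x * N\<psi> x = sqrt 2 \<longrightarrow>
                 inverse 20 * (N\<psi> x / N\<phi> x) \<le> cmod (caratheodory_fun \<mu> (complex_of_real r * z)) \<and>
                 cmod (caratheodory_fun \<mu> (complex_of_real r * z)) \<le> 20 * (N\<psi> x / N\<phi> x))"
    unfolding op Let_def
  proof (intro conjI allI impI ex; elim conjE)
    fix x assume "(1 - r) * trunc_norm \<phi> x * trunc_norm \<psi> x = sqrt 2"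
    note x = this[unfolded \<phi>_def[abs_def] \<psi>_def[abs_def]]
    show "inverse 20 * (trunc_norm \<psi> x / trunc_norm \<phi> x) \<le> cmod (caratheodory_fun \<mu> (complex_of_real r * z))"
      "cmod (caratheodory_fun \<mu> (complex_of_real r * z)) \<le> 20 * (trunc_norm \<psi> x / trunc_norm \<phi> x)"
      unfolding \<phi>_def[abs_def] \<psi>_def[abs_def]
      using jitomirskaya_last[of \<mu> a z r x, OF nontrivial_circle_measureD[OF nt] o a z r x] by simp_all
  qed
qed simp

end
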